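(* The problem 3DMatching over definable structures is undecidable: there is no algorithm which, given (finite presentations of) definable sets $A,B,C$ and a definable set $R\subseteq A\times B\times C$, decides whether there is a subset of $R$ whose projections onto $A$, $B$ and $C$ are all bijections.
   Context: Fix a countably infinite set $\mathbb{A}$ of atoms and an infinite set of atom variables. An expression is either a variable or a formal finite (possibly empty) union of set-builder expressions $\{e \mid x_1,\dots,x_k\in\mathbb{A},\ \varphi\}$ (with $k\ge 0$), where $e$ is an expression, the $x_i$ are bound variables, and $\varphi$ is a first-order formula over the atom variables with equality as the only relation symbol (interpreted in $(\mathbb{A},=)$). An expression $e$ with set of free variables $V$, together with a valuation $\sigma:V\to\mathbb{A}$, has a value $e[\sigma]$, defined in the obvious way by induction on $e$, which is an atom or a set; the sets arising this way are called definable. Pairs, tuples, integers, constants, disjoint unions etc. are encoded by standard set-theoretic means (e.g. $(x,y)=\{x,\{x,y\}\}$). A definable set is presented to an algorithm as a pair $(e,\sigma)$. The subset of $R$ sought as a solution is arbitrary (not required to be definable). *)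

theory Defs
  imports "HOL-Library.Countable_Set_Type" "HOL-Library.Nat_Bijection"
begin

section \<open>Hereditary sets over atoms\<close>

text \<open>The atoms are the natural numbers, used only through equality. All definable sets are
  hereditarily countable, so well-founded hereditarily countable sets with atoms as urelements
  suffice as values; extensionality is built into the type of countable sets.\<close>

type_synonym atom = nat

datatype hset = Atm atom | HSet "hset cset"

fun is_set :: "hset \<Rightarrow> bool" where
  "is_set (Atm a) = False"
| "is_set (HSet X) = True"

fun elems :: "hset \<Rightarrow> hset set" where
  "elems (Atm a) = {}"
| "elems (HSet X) = rcset X"

text \<open>Only meaningful for countable arguments.\<close>

definition mk_set :: "hset set \<Rightarrow> hset" where
  "mk_set S = HSet (acset S)"

lemma elems_mk_set [simp]: "countable S \<Longrightarrow> elems (mk_set S) = S"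
  by (simp add: mk_set_def acset_inverse)

lemma is_set_mk_set [simp]: "is_set (mk_set S)"
  by (simp add: mk_set_def)

lemma hset_ext:
  assumes "is_set x" "is_set y" "elems x = elems y"
  shows "x = y"
  using assms by (cases x; cases y) (auto simp: rcset_inject)

text \<open>The pairing \<open>(x, y) = {x, {x, y}}\<close>; it is injective by well-foundedness.\<close>

definition hpair :: "hset \<Rightarrow> hset \<Rightarrow> hset" where
  "hpair x y = mk_set {x, mk_set {x, y}}"

definition htriple :: "hset \<Rightarrow> hset \<Rightarrow> hset \<Rightarrow> hset" where
  "htriple x y z = hpair (hpair x y) z"

lemma elems_asym: "y \<in> elems x \<Longrightarrow> x \<notin> elems y"
proof (induction x arbitrary: y)
  case (Atm a)
  then show ?case by simp
next
  case (HSet X)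
  show ?case
  proof
    assume a: "HSet X \<in> elems y"
    have "y \<in> rcset X" using HSet.prems by simp
    from HSet.IH[OF this a] HSet.prems show False by simp
  qed
qed

lemma hpair_inject [simp]: "hpair x y = hpair x' y' \<longleftrightarrow> x = x' \<and> y = y'"
proof
  assume "hpair x y = hpair x' y'"
  then have "elems (hpair x y) = elems (hpair x' y')" by simp
  then have eq: "{x, mk_set {x, y}} = {x', mk_set {x', y'}}"
    by (simp add: hpair_def)
  have in1: "x \<in> elems (mk_set {x, y})" and in2: "x' \<in> elems (mk_set {x', y'})" by simp_all
  have xx: "x = x'"
  proof (rule ccontr)
    assume "x \<noteq> x'"
    with eq have "x = mk_set {x', y'}" "x' = mk_set {x, y}" by (auto simp: doubleton_eq_iff)
    with in1 in2 elems_asym show False by metis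
  qed
  with eq have "mk_set {x, y} = mk_set {x, y'}" by (auto simp: doubleton_eq_iff)
  then have "elems (mk_set {x, y}) = elems (mk_set {x, y'})" by simp
  then have "{x, y} = {x, y'}" by simp
  with xx show "x = x' \<and> y = y'" by (auto simp: doubleton_eq_iff)
qed simp

lemma htriple_inject [simp]:
  "htriple x y z = htriple x' y' z' \<longleftrightarrow> x = x' \<and> y = y' \<and> z = z'"
  by (auto simp: htriple_def)

definition proj1 :: "hset \<Rightarrow> hset" where
  "proj1 t = (THE x. \<exists>y z. t = htriple x y z)"

definition proj2 :: "hset \<Rightarrow> hset" where
  "proj2 t = (THE y. \<exists>x z. t = htriple x y z)"

definition proj3 :: "hset \<Rightarrow> hset" where
  "proj3 t = (THE z. \<exists>x y. t = htriple x y z)"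

lemma proj_htriple [simp]:
  "proj1 (htriple x y z) = x"
  "proj2 (htriple x y z) = y"
  "proj3 (htriple x y z) = z"
  by (auto simp: proj1_def proj2_def proj3_def)


section \<open>Set-builder expressions and their values\<close>

type_synonym var = nat
type_synonym valuation = "var \<Rightarrow> atom"

datatype fm =
    Eq var var
  | Neg fm
  | Conj fm fm
  | Disj fm fm
  | Exi var fm
  | Uni var fm

primrec sat :: "valuation \<Rightarrow> fm \<Rightarrow> bool" where
  "sat \<sigma> (Eq x y) \<longleftrightarrow> \<sigma> x = \<sigma> y"
| "sat \<sigma> (Neg p) \<longleftrightarrow> \<not> sat \<sigma> p"
| "sat \<sigma> (Conj p q) \<longleftrightarrow> sat \<sigma> p \<and> sat \<sigma> q"
| "sat \<sigma> (Disj p q) \<longleftrightarrow> sat \<sigma> p \<or> sat \<sigma> q"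
| "sat \<sigma> (Exi x p) \<longleftrightarrow> (\<exists>a. sat (\<sigma>(x := a)) p)"
| "sat \<sigma> (Uni x p) \<longleftrightarrow> (\<forall>a. sat (\<sigma>(x := a)) p)"

primrec fv_fm :: "fm \<Rightarrow> var set" where
  "fv_fm (Eq x y) = {x, y}"
| "fv_fm (Neg p) = fv_fm p"
| "fv_fm (Conj p q) = fv_fm p \<union> fv_fm q"
| "fv_fm (Disj p q) = fv_fm p \<union> fv_fm q"
| "fv_fm (Exi x p) = fv_fm p - {x}"
| "fv_fm (Uni x p) = fv_fm p - {x}"

text \<open>\<open>Builder e [x\<^sub>1, \<dots>, x\<^sub>k] \<phi>\<close> is \<open>{e | x\<^sub>1, \<dots>, x\<^sub>k \<in> \<bbbA>, \<phi>}\<close>, and \<open>FUnion\<close> is the formal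
  finite union.\<close>

datatype expr = Var var | FUnion "builder list"
  and builder = Builder expr "var list" fm

primrec fv :: "expr \<Rightarrow> var set" and fv_builder :: "builder \<Rightarrow> var set" where
  "fv (Var x) = {x}"
| "fv (FUnion bs) = \<Union>(set (map fv_builder bs))"
| "fv_builder (Builder e xs p) = (fv e \<union> fv_fm p) - set xs"

definition variants :: "valuation \<Rightarrow> var list \<Rightarrow> valuation set" where
  "variants \<sigma> xs = {\<tau>. \<forall>y. y \<notin> set xs \<longrightarrow> \<tau> y = \<sigma> y}"

primrec eval_expr :: "expr \<Rightarrow> valuation \<Rightarrow> hset"
  and eval_builder :: "builder \<Rightarrow> valuation \<Rightarrow> hset set" where
  "eval_expr (Var x) = (\<lambda>\<sigma>. Atm (\<sigma> x))"
| "eval_expr (FUnion bs) = (\<lambda>\<sigma>. mk_set (\<Union>E\<in>set (map eval_builder bs). E \<sigma>))"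
| "eval_builder (Builder e xs p) = (\<lambda>\<sigma>. {eval_expr e \<tau> | \<tau>. \<tau> \<in> variants \<sigma> xs \<and> sat \<tau> p})"

lemma countable_variants: "countable (variants \<sigma> xs)"
proof -
  have "variants \<sigma> xs \<subseteq> range (\<lambda>l y. case map_of l y of None \<Rightarrow> \<sigma> y | Some a \<Rightarrow> a)"
  proof
    fix \<tau> assume t: "\<tau> \<in> variants \<sigma> xs"
    define l where "l = map (\<lambda>x. (x, \<tau> x)) xs"
    have "\<tau> = (\<lambda>y. case map_of l y of None \<Rightarrow> \<sigma> y | Some a \<Rightarrow> a)"
      using t by (auto simp: variants_def l_def map_of_map_restrict restrict_map_def)
    then show "\<tau> \<in> range (\<lambda>l y. case map_of l y of None \<Rightarrow> \<sigma> y | Some a \<Rightarrow> a)" by blast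
  qed
  then show ?thesis by (rule countable_subset) simp
qed

lemma countable_eval_builder: "countable (eval_builder b \<sigma>)"
proof (cases b)
  case (Builder e xs p)
  have "eval_builder b \<sigma> \<subseteq> (\<lambda>\<tau>. eval_expr e \<tau>) ` variants \<sigma> xs"
    using Builder by auto
  then show ?thesis
    by (rule countable_subset) (simp add: countable_variants)
qed

lemma elems_eval_FUnion [simp]:
  "elems (eval_expr (FUnion bs) \<sigma>) = (\<Union>b\<in>set bs. eval_builder b \<sigma>)"
proof -
  have "countable (\<Union>E\<in>set (map eval_builder bs). E \<sigma>)"
    by (rule countable_UN) (auto simp: countable_finite countable_eval_builder)
  then show ?thesis by (simp del: set_map) simp
qed

lemma sat_cong: "(\<And>x. x \<in> fv_fm p \<Longrightarrow> \<sigma> x = \<tau> x) \<Longrightarrow> sat \<sigma> p = sat \<tau> p"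
proof (induction p arbitrary: \<sigma> \<tau>)
  case (Exi x p)
  have "sat (\<sigma>(x := a)) p = sat (\<tau>(x := a)) p" for a
    by (rule Exi.IH) (use Exi.prems in auto)
  then show ?case by simp
next
  case (Uni x p)
  have "sat (\<sigma>(x := a)) p = sat (\<tau>(x := a)) p" for a
    by (rule Uni.IH) (use Uni.prems in auto)
  then show ?case by simp
next
  case (Conj p q)
  have "sat \<sigma> p = sat \<tau> p" "sat \<sigma> q = sat \<tau> q"
    by (rule Conj.IH; use Conj.prems in auto)+
  then show ?case by simp
next
  case (Disj p q)
  have "sat \<sigma> p = sat \<tau> p" "sat \<sigma> q = sat \<tau> q"
    by (rule Disj.IH; use Disj.prems in auto)+
  then show ?case by simp
next
  case (Neg p)
  have "sat \<sigma> p = sat \<tau> p" by (rule Neg.IH) (use Neg.prems in auto)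
  then show ?case by simp
qed simp

lemma eval_cong:
  "(\<And>x. x \<in> fv e \<Longrightarrow> \<sigma> x = \<tau> x) \<Longrightarrow> eval_expr e \<sigma> = eval_expr e \<tau>"
  "(\<And>x. x \<in> fv_builder b \<Longrightarrow> \<sigma> x = \<tau> x) \<Longrightarrow> eval_builder b \<sigma> = eval_builder b \<tau>"
proof (induction e and b arbitrary: \<sigma> \<tau> and \<sigma> \<tau>)
  case (FUnion bs)
  have "eval_builder b \<sigma> = eval_builder b \<tau>" if "b \<in> set bs" for b
    by (rule FUnion.IH[OF that]) (use FUnion.prems that in auto)
  then show ?case by simp
next
  case (Builder e xs p)
  have *: "eval_builder (Builder e xs p) \<rho> \<subseteq> eval_builder (Builder e xs p) \<rho>'"
    if ag: "\<And>x. x \<in> fv_builder (Builder e xs p) \<Longrightarrow> \<rho> x = \<rho>' x" for \<rho> \<rho>'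
  proof
    fix v assume "v \<in> eval_builder (Builder e xs p) \<rho>"
    then obtain \<mu> where m: "v = eval_expr e \<mu>" "\<mu> \<in> variants \<rho> xs" "sat \<mu> p" by auto
    define \<nu> where "\<nu> = (\<lambda>y. if y \<in> set xs then \<mu> y else \<rho>' y)"
    have agree: "\<mu> x = \<nu> x" if "x \<in> fv e \<union> fv_fm p" for x
      using that m(2) ag[of x] by (auto simp: \<nu>_def variants_def)
    have "eval_expr e \<mu> = eval_expr e \<nu>" by (rule Builder.IH) (use agree in auto)
    moreover have "sat \<nu> p" using m(3) sat_cong[of p \<mu> \<nu>] agree by auto
    moreover have "\<nu> \<in> variants \<rho>' xs" by (auto simp: \<nu>_def variants_def)
    ultimately show "v \<in> eval_builder (Builder e xs p) \<rho>'" using m(1) by auto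
  qed
  show ?case using *[of \<sigma> \<tau>] *[of \<tau> \<sigma>] Builder.prems by (metis subset_antisym)
qed auto


section \<open>Presentations of definable sets\<close>

text \<open>A pair of an expression and a valuation of its free variables, the latter given as a
  finite graph. Outside this graph the valuation is set to \<open>0\<close>, which by
  \<open>eval_cong\<close> does not influence the value.\<close>

type_synonym presentation = "expr \<times> (var \<times> atom) list"

definition valuation_of :: "(var \<times> atom) list \<Rightarrow> valuation" where
  "valuation_of l x = (case map_of l x of None \<Rightarrow> 0 | Some a \<Rightarrow> a)"

fun value_of :: "presentation \<Rightarrow> hset" where
  "value_of (e, l) = eval_expr e (valuation_of l)"

fun presents_set :: "presentation \<Rightarrow> bool" where
  "presents_set (e, l) \<longleftrightarrow>
     distinct (map fst l) \<and> set (map fst l) = fv e \<and> is_set (value_of (e, l))"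


section \<open>3D matching over definable sets\<close>

type_synonym instance_3dm = "presentation \<times> presentation \<times> presentation \<times> presentation"

fun valid_3dm :: "instance_3dm \<Rightarrow> bool" where
  "valid_3dm (A, B, C, R) \<longleftrightarrow>
     presents_set A \<and> presents_set B \<and> presents_set C \<and> presents_set R \<and>
     elems (value_of R) \<subseteq>
       {htriple x y z | x y z.
          x \<in> elems (value_of A) \<and> y \<in> elems (value_of B) \<and> z \<in> elems (value_of C)}"

fun has_3d_matching :: "instance_3dm \<Rightarrow> bool" where
  "has_3d_matching (A, B, C, R) \<longleftrightarrow>
     (\<exists>M \<subseteq> elems (value_of R).
        bij_betw proj1 M (elems (value_of A)) \<and>
        bij_betw proj2 M (elems (value_of B)) \<and>
        bij_betw proj3 M (elems (value_of C)))"


section \<open>Algorithms: partial recursive functions\<close>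

datatype recf =
    Zero
  | Succ
  | Proj nat
  | Comp recf "recf list"
  | PrimRec recf recf
  | Mu recf

text \<open>\<open>computes f xs y\<close>: the algorithm \<open>f\<close> halts on the arguments \<open>xs\<close> with result \<open>y\<close>.
  Recursion and minimisation act on the first argument; the step function of a recursion
  receives the counter, the previous result and the parameters, in this order.\<close>

inductive computes :: "recf \<Rightarrow> nat list \<Rightarrow> nat \<Rightarrow> bool" where
  "computes Zero xs 0"
| "computes Succ [x] (Suc x)"
| "i < length xs \<Longrightarrow> computes (Proj i) xs (xs ! i)"
| "list_all2 (\<lambda>g y. computes g xs y) gs ys \<Longrightarrow> computes f ys z \<Longrightarrow> computes (Comp f gs) xs z"
| "computes f xs y \<Longrightarrow> computes (PrimRec f g) (0 # xs) y"
| "computes (PrimRec f g) (n # xs) r \<Longrightarrow> computes g (n # r # xs) y \<Longrightarrow>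
     computes (PrimRec f g) (Suc n # xs) y"
| "computes f (n # xs) 0 \<Longrightarrow> (\<forall>m<n. \<exists>k. computes f (m # xs) (Suc k)) \<Longrightarrow>
     computes (Mu f) xs n"
monos list_all2_mono

inductive_cases computes_ZeroE: "computes Zero xs y"
inductive_cases computes_SuccE: "computes Succ xs y"
inductive_cases computes_ProjE: "computes (Proj i) xs y"
inductive_cases computes_CompE: "computes (Comp f gs) xs y"
inductive_cases computes_PrimRec_0E: "computes (PrimRec f g) (0 # xs) y"
inductive_cases computes_PrimRec_SucE: "computes (PrimRec f g) (Suc n # xs) y"
inductive_cases computes_MuE: "computes (Mu f) xs y"

lemma computes_deterministic: "computes f xs y \<Longrightarrow> computes f xs z \<Longrightarrow> y = z"
proof (induction arbitrary: z rule: computes.induct)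
  case (1 xs)
  then show ?case by (rule computes_ZeroE) simp
next
  case (2 x)
  then show ?case by (rule computes_SuccE) simp
next
  case (3 i xs)
  from 3(2) show ?case by (rule computes_ProjE) simp
next
  case (4 xs gs ys f w)
  from 4(4) obtain ys' where
    ys': "list_all2 (\<lambda>g y. computes g xs y) gs ys'" "computes f ys' z"
    by (rule computes_CompE)
  have "ys = ys'"
    using 4(1) ys'(1) by (auto simp: list_all2_conv_all_nth intro!: nth_equalityI)
  with 4(2)[of z] ys'(2) show ?case by simp
next
  case (5 f xs y g)
  from 5(3) have "computes f xs z" by (rule computes_PrimRec_0E)
  then show ?case by (rule 5)
next
  case (6 f g n xs r y)
  from 6(5) obtain r' where r': "computes (PrimRec f g) (n # xs) r'" "computes g (n # r' # xs) z"
    by (rule computes_PrimRec_SucE)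
  from 6(3)[OF r'(1)] have "r = r'" .
  with r'(2) 6(4)[of z] show ?case by simp
next
  case (7 f n xs)
  from 7(4) have z: "computes f (z # xs) 0" "\<forall>m<z. \<exists>k. computes f (m # xs) (Suc k)"
    by (auto elim: computes_MuE)
  have "\<not> n < z"
  proof
    assume "n < z"
    with z(2) obtain k where "computes f (n # xs) (Suc k)" by blast
    from 7(2)[OF this] show False by simp
  qed
  moreover have "\<not> z < n"
  proof
    assume "z < n"
    with 7 obtain k where "\<forall>x. computes f (z # xs) x \<longrightarrow> Suc k = x" by blast
    with z(1) have "Suc k = 0" by blast
    then show False by simp
  qed
  ultimately show ?case by simp
qed

text \<open>Decidability of a promise problem with instances encoded as numbers: the algorithm must
  halt with the right answer on every valid instance, and is unconstrained elsewhere.\<close>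

definition decidable_problem :: "('i \<Rightarrow> nat) \<Rightarrow> ('i \<Rightarrow> bool) \<Rightarrow> ('i \<Rightarrow> bool) \<Rightarrow> bool" where
  "decidable_problem code valid yes \<longleftrightarrow>
     (\<exists>f. \<forall>i. valid i \<longrightarrow> computes f [code i] (if yes i then 1 else 0))"


section \<open>Numeric codes of instances\<close>

primrec code_fm :: "fm \<Rightarrow> nat" where
  "code_fm (Eq x y) = prod_encode (0, prod_encode (x, y))"
| "code_fm (Neg p) = prod_encode (1, code_fm p)"
| "code_fm (Conj p q) = prod_encode (2, prod_encode (code_fm p, code_fm q))"
| "code_fm (Disj p q) = prod_encode (3, prod_encode (code_fm p, code_fm q))"
| "code_fm (Exi x p) = prod_encode (4, prod_encode (x, code_fm p))"
| "code_fm (Uni x p) = prod_encode (5, prod_encode (x, code_fm p))"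

primrec code_expr :: "expr \<Rightarrow> nat" and code_builder :: "builder \<Rightarrow> nat" where
  "code_expr (Var x) = prod_encode (0, x)"
| "code_expr (FUnion bs) = prod_encode (1, list_encode (map code_builder bs))"
| "code_builder (Builder e xs p) =
     prod_encode (code_expr e, prod_encode (list_encode xs, code_fm p))"

fun code_presentation :: "presentation \<Rightarrow> nat" where
  "code_presentation (e, l) = prod_encode (code_expr e, list_encode (map prod_encode l))"

fun code_3dm :: "instance_3dm \<Rightarrow> nat" where
  "code_3dm (A, B, C, R) =
     prod_encode (code_presentation A,
       prod_encode (code_presentation B,
         prod_encode (code_presentation C, code_presentation R)))"

lemma code_fm_inject [simp]: "code_fm p = code_fm q \<longleftrightarrow> p = q"
proof (induction p arbitrary: q)
  case (Eq x y) then show ?case by (cases q) auto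
next
  case (Neg p) then show ?case by (cases q) auto
next
  case (Conj p p') then show ?case by (cases q) auto
next
  case (Disj p p') then show ?case by (cases q) auto
next
  case (Exi x p) then show ?case by (cases q) auto
next
  case (Uni x p) then show ?case by (cases q) auto
qed

lemma code_expr_inject:
  "code_expr e = code_expr e' \<Longrightarrow> e = e'"
  "code_builder b = code_builder b' \<Longrightarrow> b = b'"
proof (induction e and b arbitrary: e' and b')
  case (Var x)
  then show ?case by (cases e') auto
next
  case (FUnion bs)
  then obtain bs' where e': "e' = FUnion bs'" by (cases e') auto
  with FUnion.prems have "map code_builder bs = map code_builder bs'" by (simp add: list_encode_eq)
  then have "bs = bs'"
    by (rule list.inj_map_strong[rotated]) (use FUnion.IH in blast)
  with e' show ?case by simp
next
  case (Builder e xs p)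
  then show ?case by (cases b') (auto simp: list_encode_eq)
qed

lemma inj_code_presentation: "inj code_presentation"
proof (rule injI)
  fix p q assume "code_presentation p = code_presentation q"
  then show "p = q"
    by (cases p; cases q)
      (auto dest!: code_expr_inject(1) map_injective simp: inj_prod_encode list_encode_eq)
qed

lemma inj_code_3dm: "inj code_3dm"
  by (rule injI, elim code_3dm.elims)
    (auto dest!: injD[OF inj_code_presentation])

end

theory Submission
  imports Defs
begin

text \<open>The halting problem is reduced to the complement of 3D matching. For a recursive function \<open>g\<close> and
  an input \<open>n\<close>, consider the grid \<open>\<nat>\<^sup>K\<close>, where each cell \<open>x\<close> stores its coordinates, their successors,
  and which facts "\<open>f\<close> maps these coordinates to that coordinate" hold, for the subterms \<open>f\<close> of \<open>g\<close>.
  For large \<open>K\<close> each rule of \<open>computes\<close> is a condition on single cells, provided that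
  the truth value of a fact does not change along the coordinates it does not mention. So \<open>g\<close> diverges
  on \<open>n\<close> iff the cells can be filled consistently without establishing that \<open>g\<close> has a value at \<open>n\<close>.

  A filling is a set of tuples of atoms that contains one tuple for each \<open>x\<close> and is closed under two
  moves, and this is what a matching can express. Atoms carry no successor function; the
  matching chooses one, and it is only controlled on the part of the grid reachable from the origin. In the
  other direction, the atoms are the natural numbers and the true facts give a filling.

  The code of the instance is a recursive function of \<open>n\<close>, so a decision procedure would yield a
  function \<open>g\<close> that, on (a number describing) itself, halts iff it diverges.\<close>


section \<open>Tuples of atoms\<close>

text \<open>\<open>fm\<close> has no constant for truth. Binding the variable keeps this substitute
  closed, so it adds nothing to the free variables of a presentation.\<close>

definition truth :: fm where
  "truth = Exi 0 (Eq 0 0)"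

lemma sat_truth [simp]: "sat \<sigma> truth"
  and fv_truth [simp]: "fv_fm truth = {}"
  by (auto simp: truth_def)

lemma variants_Nil [simp]: "variants \<sigma> [] = {\<sigma>}"
  by (auto simp: variants_def)

definition pair_expr :: "expr \<Rightarrow> expr \<Rightarrow> expr" where
  "pair_expr e e' = FUnion [Builder e [] truth,
     Builder (FUnion [Builder e [] truth, Builder e' [] truth]) [] truth]"

lemma eval_pair_expr [simp]:
  "eval_expr (pair_expr e e') \<sigma> = hpair (eval_expr e \<sigma>) (eval_expr e' \<sigma>)"
  by (auto simp: pair_expr_def hpair_def insert_commute)

lemma fv_pair_expr [simp]: "fv (pair_expr e e') = fv e \<union> fv e'"
  by (auto simp: pair_expr_def)

definition triple_expr :: "expr \<Rightarrow> expr \<Rightarrow> expr \<Rightarrow> expr" where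
  "triple_expr a b c = pair_expr (pair_expr a b) c"

lemma eval_triple_expr [simp]:
  "eval_expr (triple_expr a b c) \<sigma> = htriple (eval_expr a \<sigma>) (eval_expr b \<sigma>) (eval_expr c \<sigma>)"
  by (simp add: triple_expr_def htriple_def)

lemma fv_triple_expr [simp]: "fv (triple_expr a b c) = fv a \<union> fv b \<union> fv c"
  by (simp add: triple_expr_def)

primrec tuple_expr :: "var list \<Rightarrow> expr" where
  "tuple_expr [] = FUnion []"
| "tuple_expr (x # xs) = pair_expr (Var x) (tuple_expr xs)"

primrec tuple :: "atom list \<Rightarrow> hset" where
  "tuple [] = mk_set {}"
| "tuple (a # as) = hpair (Atm a) (tuple as)"

lemma eval_tuple_expr [simp]: "eval_expr (tuple_expr xs) \<sigma> = tuple (map \<sigma> xs)"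
  by (induction xs) auto

lemma fv_tuple_expr [simp]: "fv (tuple_expr xs) = set xs"
  by (induction xs) auto

lemma hpair_neq_empty: "hpair x y \<noteq> mk_set {}"
proof
  assume "hpair x y = mk_set {}"
  then have "elems (hpair x y) = elems (mk_set {})" by simp
  then show False by (simp add: hpair_def)
qed

lemma tuple_inject [simp]: "tuple as = tuple bs \<longleftrightarrow> as = bs"
proof (induction as arbitrary: bs)
  case Nil
  show ?case using hpair_neq_empty by (cases bs) (auto, metis)
next
  case (Cons a as)
  then show ?case using hpair_neq_empty by (cases bs) auto
qed

lemma variant_of_list:
  assumes "distinct xs" "length as = length xs"
  shows "\<exists>\<tau>\<in>variants \<sigma> xs. map \<tau> xs = as"
proof
  let ?\<tau> = "\<lambda>x. case map_of (zip xs as) x of None \<Rightarrow> \<sigma> x | Some a \<Rightarrow> a"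
  have "x \<notin> set xs \<Longrightarrow> map_of (zip xs as) x = None" for x
    using assms by (simp add: map_of_zip_is_None)
  then show "?\<tau> \<in> variants \<sigma> xs" by (auto simp: variants_def)
  show "map ?\<tau> xs = as"
    using assms by (auto intro!: nth_equalityI simp: map_of_zip_nth)
qed

lemma variants_eqI:
  "\<tau> \<in> variants \<sigma> xs \<Longrightarrow> \<tau>' \<in> variants \<sigma> xs \<Longrightarrow> map \<tau> xs = map \<tau>' xs \<Longrightarrow> \<tau> = \<tau>'"
  by (rule ext) (auto simp: variants_def)

definition all_tuples :: "nat \<Rightarrow> builder" where
  "all_tuples k = Builder (tuple_expr [0..<k]) [0..<k] truth"

lemma eval_all_tuples [simp]: "eval_builder (all_tuples k) \<sigma> = tuple ` {as. length as = k}"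
proof -
  have "\<exists>\<tau>. tuple as = tuple (map \<tau> [0..<k]) \<and> \<tau> \<in> variants \<sigma> [0..<k]"
    if "length as = k" for as
    using variant_of_list[of "[0..<k]" as \<sigma>] that by force
  then show ?thesis by (auto simp: all_tuples_def simp del: tuple_inject)
qed

lemma fv_all_tuples [simp]: "fv_builder (all_tuples k) = {}"
  by (auto simp: all_tuples_def)


section \<open>The matching gadget\<close>

text \<open>Each projection of a matching is assembled from such pieces, one for every kind of
  triple.\<close>

lemma bij_betw_tuple:
  assumes "\<And>i. i \<in> I \<Longrightarrow> p (g i) = tuple (h i)" "inj_on h I" "h ` I = T"
  shows "bij_betw p (g ` I) (tuple ` T)"
proof -
  have "inj_on p (g ` I)"
  proof (rule inj_onI)
    fix x y assume "x \<in> g ` I" "y \<in> g ` I" "p x = p y"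
    then obtain i j where ij: "x = g i" "y = g j" "i \<in> I" "j \<in> I" "tuple (h i) = tuple (h j)"
      using assms(1) by auto
    then have "i = j" using assms(2) by (simp add: inj_on_eq_iff)
    then show "x = y" using ij by simp
  qed
  moreover have "p ` g ` I = tuple ` T"
    unfolding assms(3)[symmetric] image_image using assms(1) by (intro image_cong) auto
  ultimately show ?thesis by (simp add: bij_betw_def)
qed

lemma bij_betw_tuple_Un:
  assumes "bij_betw p S (tuple ` T)" "bij_betw p S' (tuple ` T')" "T \<inter> T' = {}"
  shows "bij_betw p (S \<union> S') (tuple ` (T \<union> T'))"
proof -
  have "tuple ` T \<inter> tuple ` T' = {}" using assms(3) by auto
  then show ?thesis using bij_betw_combine[OF assms(1,2)] by (simp add: image_Un)
qed

lemma bij_betw_singletons: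
  fixes h :: "'a \<Rightarrow> nat"
  assumes "bij_betw h S UNIV"
  shows "inj_on (\<lambda>x. [h x]) S" "(\<lambda>x. [h x]) ` S = {as. length as = 1}"
proof -
  show "inj_on (\<lambda>x. [h x]) S" using assms by (simp add: bij_betw_def inj_on_def)
  have "(\<lambda>x. [h x]) ` S = (\<lambda>a. [a]) ` h ` S" by (simp add: image_image)
  also have "\<dots> = range (\<lambda>a. [a])" using assms by (simp add: bij_betw_def)
  also have "\<dots> = {as. length as = 1}" by (auto simp: length_Suc_conv)
  finally show "(\<lambda>x. [h x]) ` S = {as. length as = 1}" .
qed

text \<open>The solutions of this instance correspond to the sets \<open>Z\<close> of valuations of \<open>zs\<close> satisfying \<open>\<phi>\<close>
  in which every tuple of values of \<open>rs\<close> occurs exactly once and the set of values of \<open>ws\<close> contains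
  those of \<open>ps\<close> and \<open>us\<close>. No tags are needed to keep the elements apart, since tuples of different
  lengths are different.\<close>

locale matching_gadget =
  fixes zs rs ws ps us :: "var list" and \<phi> :: fm and l :: "(var \<times> atom) list"
  assumes distinct_zs: "distinct zs"
    and subs: "set rs \<subseteq> set ws" "set ws \<subseteq> set zs" "set ps \<subseteq> set zs" "set us \<subseteq> set zs"
    and lens: "length ps = length ws" "length us = length ws"
      "1 < length rs" "length rs < length ws" "length ws < length zs"
    and l: "distinct (map fst l)" "set (map fst l) = fv_fm \<phi> - set zs"
begin

abbreviation \<sigma> :: valuation where "\<sigma> \<equiv> valuation_of l"
abbreviation N :: nat where "N \<equiv> length zs"
abbreviation n :: nat where "n \<equiv> length ws"
abbreviation K :: nat where "K \<equiv> length rs"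

definition A :: presentation where
  "A = (FUnion [all_tuples K, all_tuples n, all_tuples 1], [])"
definition B :: presentation where
  "B = (FUnion [all_tuples n, all_tuples N, all_tuples 1], [])"
definition C :: presentation where
  "C = (FUnion [all_tuples N, all_tuples n], [])"

text \<open>These builders do not involve \<phi> or \<open>l\<close>, so their code is a constant of
  the reduction. The variables \<open>N\<close>, \<open>n\<close> and \<open>Suc n\<close> are
  chosen outside the ranges bound next to them.\<close>

definition rest :: "builder list" where
  "rest = [Builder (triple_expr (tuple_expr ps) (tuple_expr zs) (tuple_expr us)) zs truth,
     Builder (triple_expr (tuple_expr [N]) (tuple_expr [0..<N]) (tuple_expr [0..<N]))
       (N # [0..<N]) truth,
     Builder (triple_expr (tuple_expr [0..<n]) (tuple_expr [0..<n]) (tuple_expr [0..<n]))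
       [0..<n] truth,
     Builder (triple_expr (tuple_expr [n]) (tuple_expr [Suc n]) (tuple_expr [0..<n]))
       (n # Suc n # [0..<n]) truth]"

definition present_expr :: expr where
  "present_expr = triple_expr (tuple_expr rs) (tuple_expr ws) (tuple_expr zs)"

definition R :: presentation where
  "R = (FUnion (Builder present_expr zs \<phi> # rest), l)"

definition I :: instance_3dm where
  "I = (A, B, C, R)"

text \<open>A valuation is in \<open>Z\<close> iff its triples \<open>q1\<close> and \<open>q2\<close> are both chosen; otherwise \<open>unused\<close> covers the
  two elements that tie them together. A tuple \<open>as\<close> is not a value of \<open>ws\<close> iff \<open>absent as\<close> is chosen,
  which keeps \<open>as\<close> from being a value of \<open>ps\<close> or \<open>us\<close>. Values of \<open>ws\<close> that are not values of \<open>us\<close> are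
  covered by \<open>slack\<close>. The pads \<open>tuple [c]\<close> can be used up exactly, as in Hilbert's hotel, whenever
  infinitely many of them are needed.\<close>

definition q1 :: "valuation \<Rightarrow> hset" where
  "q1 \<tau> = htriple (tuple (map \<tau> rs)) (tuple (map \<tau> ws)) (tuple (map \<tau> zs))"
definition q2 :: "valuation \<Rightarrow> hset" where
  "q2 \<tau> = htriple (tuple (map \<tau> ps)) (tuple (map \<tau> zs)) (tuple (map \<tau> us))"
definition absent :: "atom list \<Rightarrow> hset" where
  "absent as = htriple (tuple as) (tuple as) (tuple as)"
definition unused :: "atom \<Rightarrow> atom list \<Rightarrow> hset" where
  "unused c as = htriple (tuple [c]) (tuple as) (tuple as)"
definition slack :: "atom \<Rightarrow> atom \<Rightarrow> atom list \<Rightarrow> hset" where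
  "slack c d as = htriple (tuple [c]) (tuple [d]) (tuple as)"

definition Q1 :: "hset set" where "Q1 = q1 ` {\<tau> \<in> variants \<sigma> zs. sat \<tau> \<phi>}"
definition Q2 :: "hset set" where "Q2 = q2 ` variants \<sigma> zs"
definition Unused :: "hset set" where "Unused = {unused c as | c as. length as = N}"
definition Absent :: "hset set" where "Absent = absent ` {as. length as = n}"
definition Slack :: "hset set" where "Slack = {slack c d as | c d as. length as = n}"

section \<open>Values and validity of the instance\<close>

lemma elems_A [simp]:
  "elems (value_of A) = tuple ` {as. length as = K} \<union> tuple ` {as. length as = n} \<union> tuple ` {as. length as = 1}"
  by (auto simp: A_def valuation_of_def simp del: elems.simps eval_expr.simps)

lemma elems_B [simp]:
  "elems (value_of B) = tuple ` {as. length as = n} \<union> tuple ` {as. length as = N} \<union> tuple ` {as. length as = 1}"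
  by (auto simp: B_def valuation_of_def simp del: elems.simps eval_expr.simps)

lemma elems_C [simp]:
  "elems (value_of C) = tuple ` {as. length as = N} \<union> tuple ` {as. length as = n}"
  by (auto simp: C_def valuation_of_def simp del: elems.simps eval_expr.simps)

lemma eval_Unused:
  "eval_builder (Builder (triple_expr (tuple_expr [N]) (tuple_expr [0..<N]) (tuple_expr [0..<N]))
       (N # [0..<N]) truth) \<sigma> = Unused"
proof -
  have "\<exists>\<tau>. unused c as = htriple (tuple [\<tau> N]) (tuple (map \<tau> [0..<N])) (tuple (map \<tau> [0..<N]))
      \<and> \<tau> \<in> variants \<sigma> (N # [0..<N])" if "length as = N" for c as
    using variant_of_list[of "N # [0..<N]" "c # as" \<sigma>] that unfolding unused_def by fastforce
  then show ?thesis by (auto simp: Unused_def unused_def simp del: tuple_inject htriple_inject) (force simp del: tuple_inject htriple_inject)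
qed

lemma eval_Absent:
  "eval_builder (Builder (triple_expr (tuple_expr [0..<n]) (tuple_expr [0..<n]) (tuple_expr [0..<n]))
       [0..<n] truth) \<sigma> = Absent"
proof -
  have "\<exists>\<tau>. absent as = htriple (tuple (map \<tau> [0..<n])) (tuple (map \<tau> [0..<n])) (tuple (map \<tau> [0..<n]))
      \<and> \<tau> \<in> variants \<sigma> [0..<n]" if "length as = n" for as
    using variant_of_list[of "[0..<n]" as \<sigma>] that unfolding absent_def by fastforce
  then show ?thesis by (auto simp: Absent_def absent_def simp del: tuple_inject htriple_inject)
qed

lemma eval_Slack:
  "eval_builder (Builder (triple_expr (tuple_expr [n]) (tuple_expr [Suc n]) (tuple_expr [0..<n]))
       (n # Suc n # [0..<n]) truth) \<sigma> = Slack"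
proof -
  have "\<exists>\<tau>. slack c d as = htriple (tuple [\<tau> n]) (tuple [\<tau> (Suc n)]) (tuple (map \<tau> [0..<n]))
      \<and> \<tau> \<in> variants \<sigma> (n # Suc n # [0..<n])" if "length as = n" for c d as
    using variant_of_list[of "n # Suc n # [0..<n]" "c # d # as" \<sigma>] that unfolding slack_def by fastforce
  then show ?thesis by (auto simp: Slack_def slack_def simp del: tuple_inject htriple_inject) (force simp del: tuple_inject htriple_inject)
qed

lemma elems_R: "elems (value_of R) = Q1 \<union> Q2 \<union> Unused \<union> Absent \<union> Slack"
proof -
  have *: "eval_builder (Builder present_expr zs \<phi>) \<sigma> = Q1"
    by (auto simp: Q1_def q1_def present_expr_def)
  have **: "eval_builder (Builder (triple_expr (tuple_expr ps) (tuple_expr zs) (tuple_expr us)) zs truth) \<sigma> = Q2"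
    by (auto simp: Q2_def q2_def)
  show ?thesis
    unfolding R_def rest_def value_of.simps elems_eval_FUnion
    by (simp only: list.set UN_insert * ** eval_Unused eval_Absent eval_Slack) auto
qed

lemma valid: "valid_3dm I"
proof -
  have "fv (fst R) = fv_fm \<phi> - set zs"
    using subs by (auto simp: R_def rest_def present_expr_def)
  then have "presents_set R"
    using l by (simp add: R_def)
  moreover have "presents_set A" "presents_set B" "presents_set C"
    by (auto simp: A_def B_def C_def)
  moreover have "elems (value_of R) \<subseteq>
       {htriple x y z | x y z.
          x \<in> elems (value_of A) \<and> y \<in> elems (value_of B) \<and> z \<in> elems (value_of C)}"
    unfolding elems_R using lens
    by (auto simp: Q1_def Q2_def Unused_def Absent_def Slack_def
        q1_def q2_def unused_def absent_def slack_def simp del: tuple.simps)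
  ultimately show ?thesis by (simp add: I_def)
qed


lemma in_R_cases:
  assumes "t \<in> elems (value_of R)"
  obtains (Q1) \<tau> where "t = q1 \<tau>" "\<tau> \<in> variants \<sigma> zs" "sat \<tau> \<phi>"
  | (Q2) \<tau> where "t = q2 \<tau>" "\<tau> \<in> variants \<sigma> zs"
  | (Unused) c as where "t = unused c as" "length as = N"
  | (Absent) as where "t = absent as" "length as = n"
  | (Slack) c d as where "t = slack c d as" "length as = n"
  using assms unfolding elems_R Q1_def Q2_def Unused_def Absent_def Slack_def by blast

section \<open>Matchings and sets of valuations\<close>

lemma proj_simps [simp]:
  "proj1 (q1 \<tau>) = tuple (map \<tau> rs)" "proj2 (q1 \<tau>) = tuple (map \<tau> ws)" "proj3 (q1 \<tau>) = tuple (map \<tau> zs)"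
  "proj1 (q2 \<tau>) = tuple (map \<tau> ps)" "proj2 (q2 \<tau>) = tuple (map \<tau> zs)" "proj3 (q2 \<tau>) = tuple (map \<tau> us)"
  "proj1 (unused c as) = tuple [c]" "proj2 (unused c as) = tuple as" "proj3 (unused c as) = tuple as"
  "proj1 (absent as) = tuple as" "proj2 (absent as) = tuple as" "proj3 (absent as) = tuple as"
  "proj1 (slack c d as) = tuple [c]" "proj2 (slack c d as) = tuple [d]" "proj3 (slack c d as) = tuple as"
  by (simp_all add: q1_def q2_def unused_def absent_def slack_def del: tuple.simps)

lemma matching_imp:
  assumes "has_3d_matching I"
  obtains Z where "Z \<subseteq> variants \<sigma> zs" "\<And>\<tau>. \<tau> \<in> Z \<Longrightarrow> sat \<tau> \<phi>"
    "\<And>as. length as = K \<Longrightarrow> \<exists>!\<tau>. \<tau> \<in> Z \<and> map \<tau> rs = as"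
    "\<And>\<tau>. \<tau> \<in> Z \<Longrightarrow> \<exists>\<tau>'\<in>Z. map \<tau>' ws = map \<tau> ps"
    "\<And>\<tau>. \<tau> \<in> Z \<Longrightarrow> \<exists>\<tau>'\<in>Z. map \<tau>' ws = map \<tau> us"
proof -
  from assms obtain M where M: "M \<subseteq> elems (value_of R)"
    "bij_betw proj1 M (elems (value_of A))"
    "bij_betw proj2 M (elems (value_of B))"
    "bij_betw proj3 M (elems (value_of C))"
    unfolding I_def by auto
  have inj1: "s = t" if "s \<in> M" "t \<in> M" "proj1 s = proj1 t" for s t
    using that M(2) by (meson bij_betw_def inj_onD)
  have inj2: "s = t" if "s \<in> M" "t \<in> M" "proj2 s = proj2 t" for s t
    using that M(3) by (meson bij_betw_def inj_onD)
  have inj3: "s = t" if "s \<in> M" "t \<in> M" "proj3 s = proj3 t" for s t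
    using that M(4) by (meson bij_betw_def inj_onD)
  have ex1: "\<exists>t\<in>M. proj1 t = tuple as" if "length as \<in> {K, n, 1}" for as
  proof -
    have "tuple as \<in> proj1 ` M" using M(2) that by (auto simp: bij_betw_def)
    then show ?thesis by force
  qed
  have ex2: "\<exists>t\<in>M. proj2 t = tuple as" if "length as \<in> {n, N, 1}" for as
  proof -
    have "tuple as \<in> proj2 ` M" using M(3) that by (auto simp: bij_betw_def)
    then show ?thesis by force
  qed
  have ex3: "\<exists>t\<in>M. proj3 t = tuple as" if "length as \<in> {n, N}" for as
  proof -
    have "tuple as \<in> proj3 ` M" using M(4) that by (auto simp: bij_betw_def)
    then show ?thesis by force
  qed
  define Z where "Z = {\<tau> \<in> variants \<sigma> zs. sat \<tau> \<phi> \<and> q1 \<tau> \<in> M}"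
  have q1_eq: "\<tau> = \<tau>'" if "q1 \<tau> = q1 \<tau>'" "\<tau> \<in> variants \<sigma> zs" "\<tau>' \<in> variants \<sigma> zs" for \<tau> \<tau>'
    using that variants_eqI by (simp add: q1_def)
  have root: "\<exists>!\<tau>. \<tau> \<in> Z \<and> map \<tau> rs = as" if as: "length as = K" for as
  proof -
    obtain t where t: "t \<in> M" "proj1 t = tuple as" using ex1 as by blast
    with M(1) have "t \<in> elems (value_of R)" by blast
    then have "\<exists>\<tau>. \<tau> \<in> Z \<and> map \<tau> rs = as"
      using t as lens by (cases rule: in_R_cases) (auto simp: Z_def simp del: tuple.simps)
    moreover have "\<tau> = \<tau>'" if "\<tau> \<in> Z" "\<tau>' \<in> Z" "map \<tau> rs = map \<tau>' rs" for \<tau> \<tau>'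
      using inj1[of "q1 \<tau>" "q1 \<tau>'"] that q1_eq by (auto simp: Z_def)
    ultimately show ?thesis by metis
  qed
  have present: "\<exists>\<tau>'\<in>Z. map \<tau>' ws = as" if as: "length as = n" "absent as \<notin> M" for as
  proof -
    obtain t where t: "t \<in> M" "proj2 t = tuple as" using ex2 as by blast
    with M(1) have "t \<in> elems (value_of R)" by blast
    then show ?thesis
      using t as lens by (cases rule: in_R_cases) (auto simp: Z_def simp del: tuple.simps)
  qed
  have q2: "q2 \<tau> \<in> M" if \<tau>: "\<tau> \<in> Z" for \<tau>
  proof -
    obtain t where t: "t \<in> M" "proj2 t = tuple (map \<tau> zs)" using ex2[of "map \<tau> zs"] by auto
    with M(1) have "t \<in> elems (value_of R)" by blast
    then show ?thesis
    proof (cases rule: in_R_cases)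
      case (Q2 \<tau>')
      with t \<tau> variants_eqI[of \<tau>' \<sigma> zs \<tau>] show ?thesis by (simp add: Z_def)
    next
      case (Unused c as)
      with t \<tau> inj3[of t "q1 \<tau>"] have "t = q1 \<tau>" by (simp add: Z_def)
      with t(2) have "map \<tau> ws = map \<tau> zs" by simp
      with lens show ?thesis by (metis length_map less_irrefl)
    qed (use t lens in \<open>auto dest!: arg_cong[of _ _ length] simp del: tuple.simps\<close>)
  qed
  have neq: "absent as \<noteq> q2 \<tau>" if "length as = n" for as \<tau>
  proof
    assume "absent as = q2 \<tau>"
    then have "proj2 (absent as) = proj2 (q2 \<tau>)" by simp
    with that lens show False by (auto dest!: arg_cong[of _ _ length])
  qed
  have closed: "\<exists>\<tau>'\<in>Z. map \<tau>' ws = map \<tau> ps" "\<exists>\<tau>'\<in>Z. map \<tau>' ws = map \<tau> us"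
    if "\<tau> \<in> Z" for \<tau>
  proof -
    have "absent (map \<tau> ps) \<notin> M" using inj1[OF _ q2[OF that]] neq lens by fastforce
    then show "\<exists>\<tau>'\<in>Z. map \<tau>' ws = map \<tau> ps" using present lens by simp
    have "absent (map \<tau> us) \<notin> M" using inj3[OF _ q2[OF that]] neq lens by fastforce
    then show "\<exists>\<tau>'\<in>Z. map \<tau>' ws = map \<tau> us" using present lens by simp
  qed
  have "Z \<subseteq> variants \<sigma> zs" "\<And>\<tau>. \<tau> \<in> Z \<Longrightarrow> sat \<tau> \<phi>" by (auto simp: Z_def)
  then show thesis using root closed by (rule that)
qed

lemma matching_if:
  assumes Z: "Z \<subseteq> variants \<sigma> zs" "\<And>\<tau>. \<tau> \<in> Z \<Longrightarrow> sat \<tau> \<phi>"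
    and root: "bij_betw (\<lambda>\<tau>. map \<tau> rs) Z {as. length as = K}"
    and ps: "inj_on (\<lambda>\<tau>. map \<tau> ps) Z" "(\<lambda>\<tau>. map \<tau> ps) ` Z = (\<lambda>\<tau>. map \<tau> ws) ` Z"
    and us: "inj_on (\<lambda>\<tau>. map \<tau> us) Z" "(\<lambda>\<tau>. map \<tau> us) ` Z \<subseteq> (\<lambda>\<tau>. map \<tau> ws) ` Z"
    and inf: "infinite ((\<lambda>\<tau>. map \<tau> ws) ` Z - (\<lambda>\<tau>. map \<tau> us) ` Z)"
  shows "has_3d_matching I"
proof -
  define W where "W = (\<lambda>\<tau>. map \<tau> ws) ` Z"
  define U where "U = (\<lambda>\<tau>. map \<tau> us) ` Z"
  define Zl where "Zl = (\<lambda>\<tau>. map \<tau> zs) ` Z"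
  define D3 where "D3 = {as. length as = N} - Zl"
  define D4 where "D4 = {as. length as = n} - W"
  define D5 where "D5 = W - U"
  have W_len: "length as = n" if "as \<in> W" for as using that by (auto simp: W_def)
  have U_len: "length as = n" if "as \<in> U" for as using that lens by (auto simp: U_def)
  have UW: "U \<subseteq> W" using us by (simp add: U_def W_def)
  have Zl_len: "length as = N" if "as \<in> Zl" for as using that by (auto simp: Zl_def)
  have inj_ws: "inj_on (\<lambda>\<tau>. map \<tau> ws) Z"
  proof (rule inj_onI)
    fix \<tau> \<tau>' assume "\<tau> \<in> Z" "\<tau>' \<in> Z" "map \<tau> ws = map \<tau>' ws"
    moreover from this have "map \<tau> rs = map \<tau>' rs" using subs(1) by auto
    ultimately show "\<tau> = \<tau>'" using root by (auto simp: bij_betw_def dest: inj_onD)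
  qed
  have inj_zs: "inj_on (\<lambda>\<tau>. map \<tau> zs) Z"
    using variants_eqI Z(1) by (auto intro!: inj_onI) blast
  have inf5: "infinite D5" using inf by (simp add: D5_def W_def U_def)
  define h where "h = to_nat_on (D3 \<union> D5)"
  define k where "k = to_nat_on D5"
  have h: "bij_betw h (D3 \<union> D5) UNIV" unfolding h_def
    using inf5 by (intro to_nat_on_infinite) auto
  have k: "bij_betw k D5 UNIV" unfolding k_def
    using inf5 by (intro to_nat_on_infinite) auto
  define M1 M2 M3 M4 M5 where M_defs: "M1 = q1 ` Z" "M2 = q2 ` Z"
    "M3 = (\<lambda>as. unused (h as) as) ` D3" "M4 = absent ` D4"
    "M5 = (\<lambda>as. slack (h as) (k as) as) ` D5"
  define M where "M = M1 \<union> M2 \<union> M3 \<union> M4 \<union> M5"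
  have sub: "M \<subseteq> elems (value_of R)"
    using Z W_len unfolding elems_R M_def M_defs Q1_def Q2_def Unused_def Absent_def Slack_def D3_def D4_def D5_def
    by blast
  have D35: "D3 \<inter> D5 = {}" using W_len lens by (auto simp: D3_def D5_def)
  define H where "H = (\<lambda>as. [h as])"
  have inj_H: "inj_on H (D3 \<union> D5)" and H: "H ` (D3 \<union> D5) = {as. length as = 1}"
    using bij_betw_singletons[OF h] by (simp_all add: H_def)
  have H_Un: "H ` D3 \<union> H ` D5 = {as. length as = 1}" using H by (simp add: image_Un)
  have inj_H3: "inj_on H D3" and inj_H5: "inj_on H D5"
    using inj_H by (auto intro: inj_on_subset)
  have H_disj: "H ` D3 \<inter> H ` D5 = {}"
    using inj_on_image_Int[OF inj_H, of D3 D5] D35 by simp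
  have roots: "(\<lambda>\<tau>. map \<tau> rs) ` Z = {as. length as = K}" and inj_root: "inj_on (\<lambda>\<tau>. map \<tau> rs) Z"
    using root by (auto simp: bij_betw_def)
  have D4W: "W \<inter> D4 = {}" "W \<union> D4 = {as. length as = n}" using W_len by (auto simp: D4_def)
  have D3Z: "Zl \<inter> D3 = {}" "Zl \<union> D3 = {as. length as = N}" using Zl_len by (auto simp: D3_def)
  have D5U: "U \<inter> D5 = {}" "U \<union> D5 = W" using UW by (auto simp: D5_def)
  have len_disj: "{as. length as = i} \<inter> {as. length as = j} = {}" if "i \<noteq> j" for i j :: nat
    using that by auto
  have "bij_betw proj1 M1 (tuple ` {as. length as = K})" unfolding M_defs
    by (rule bij_betw_tuple[OF _ inj_root roots]) simp
  moreover have "bij_betw proj1 M2 (tuple ` W)" unfolding M_defs W_def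
    by (rule bij_betw_tuple[OF _ ps]) simp
  moreover have "bij_betw proj1 M3 (tuple ` (H ` D3))" unfolding M_defs
    by (rule bij_betw_tuple[OF _ inj_H3 refl]) (simp add: H_def)
  moreover have "bij_betw proj1 M4 (tuple ` D4)" unfolding M_defs
    by (rule bij_betw_tuple[where h = "\<lambda>as. as"]) auto
  moreover have "bij_betw proj1 M5 (tuple ` (H ` D5))" unfolding M_defs
    by (rule bij_betw_tuple[OF _ inj_H5 refl]) (simp add: H_def)
  ultimately have "bij_betw proj1 ((M1 \<union> (M2 \<union> M4)) \<union> (M3 \<union> M5))
      (tuple ` (({as. length as = K} \<union> (W \<union> D4)) \<union> (H ` D3 \<union> H ` D5)))"
    using D4W lens H_Un H_disj len_disj
    by (intro bij_betw_tuple_Un) auto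
  then have p1: "bij_betw proj1 M (elems (value_of A))"
    unfolding M_def D4W H_Un elems_A by (simp add: Un_ac image_Un)
  have "bij_betw proj2 M1 (tuple ` W)" unfolding M_defs W_def
    by (rule bij_betw_tuple[OF _ inj_ws refl]) simp
  moreover have "bij_betw proj2 M2 (tuple ` Zl)" unfolding M_defs Zl_def
    by (rule bij_betw_tuple[OF _ inj_zs refl]) simp
  moreover have "bij_betw proj2 M3 (tuple ` D3)" unfolding M_defs
    by (rule bij_betw_tuple[where h = "\<lambda>as. as"]) auto
  moreover have "bij_betw proj2 M4 (tuple ` D4)" unfolding M_defs
    by (rule bij_betw_tuple[where h = "\<lambda>as. as"]) auto
  moreover have "bij_betw proj2 M5 (tuple ` {as. length as = 1})" unfolding M_defs
    by (rule bij_betw_tuple[OF _ bij_betw_singletons[OF k]]) simp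
  ultimately have "bij_betw proj2 (((M1 \<union> M4) \<union> (M2 \<union> M3)) \<union> M5)
      (tuple ` (((W \<union> D4) \<union> (Zl \<union> D3)) \<union> {as. length as = 1}))"
    using D4W D3Z lens len_disj
    by (intro bij_betw_tuple_Un) auto
  then have p2: "bij_betw proj2 M (elems (value_of B))"
    unfolding M_def D4W D3Z elems_B by (simp add: Un_ac image_Un)
  have "bij_betw proj3 M1 (tuple ` Zl)" unfolding M_defs Zl_def
    by (rule bij_betw_tuple[OF _ inj_zs refl]) simp
  moreover have "bij_betw proj3 M2 (tuple ` U)" unfolding M_defs U_def
    by (rule bij_betw_tuple[OF _ us(1) refl]) simp
  moreover have "bij_betw proj3 M3 (tuple ` D3)" unfolding M_defs
    by (rule bij_betw_tuple[where h = "\<lambda>as. as"]) auto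
  moreover have "bij_betw proj3 M4 (tuple ` D4)" unfolding M_defs
    by (rule bij_betw_tuple[where h = "\<lambda>as. as"]) auto
  moreover have "bij_betw proj3 M5 (tuple ` D5)" unfolding M_defs
    by (rule bij_betw_tuple[where h = "\<lambda>as. as"]) auto
  ultimately have "bij_betw proj3 ((M1 \<union> M3) \<union> ((M2 \<union> M5) \<union> M4))
      (tuple ` ((Zl \<union> D3) \<union> ((U \<union> D5) \<union> D4)))"
    using D4W D3Z D5U lens len_disj
    by (intro bij_betw_tuple_Un) auto
  then have p3: "bij_betw proj3 M (elems (value_of C))"
    unfolding M_def D5U D4W D3Z elems_C by (simp add: Un_ac image_Un)
  show ?thesis unfolding I_def has_3d_matching.simps using sub p1 p2 p3 by blast
qed

end


section \<open>Equality types\<close>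

definition conj_list :: "fm list \<Rightarrow> fm" where
  "conj_list ps = foldr Conj ps truth"

definition disj_list :: "fm list \<Rightarrow> fm" where
  "disj_list ps = foldr Disj ps (Neg truth)"

lemma sat_conj_list [simp]: "sat \<sigma> (conj_list ps) \<longleftrightarrow> (\<forall>p\<in>set ps. sat \<sigma> p)"
  unfolding conj_list_def by (induction ps) auto

lemma fv_conj_list [simp]: "fv_fm (conj_list ps) = (\<Union>p\<in>set ps. fv_fm p)"
  unfolding conj_list_def by (induction ps) auto

lemma sat_disj_list [simp]: "sat \<sigma> (disj_list ps) \<longleftrightarrow> (\<exists>p\<in>set ps. sat \<sigma> p)"
  unfolding disj_list_def by (induction ps) auto

lemma fv_disj_list [simp]: "fv_fm (disj_list ps) = (\<Union>p\<in>set ps. fv_fm p)"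
  unfolding disj_list_def by (induction ps) auto

definition same_type :: "var set \<Rightarrow> valuation \<Rightarrow> valuation \<Rightarrow> bool" where
  "same_type V \<sigma> \<tau> \<longleftrightarrow> (\<forall>u\<in>V. \<forall>v\<in>V. \<sigma> u = \<sigma> v \<longleftrightarrow> \<tau> u = \<tau> v)"

text \<open>A finite set of variables has only finitely many equality patterns, so a finite
  disjunction suffices for every \<open>T\<close>, however complicated.\<close>

lemma ex_type_formula:
  assumes "finite V"
  shows "\<exists>\<psi>. fv_fm \<psi> \<subseteq> V \<and> (\<forall>\<sigma>. sat \<sigma> \<psi> \<longleftrightarrow> (\<exists>\<tau>\<in>T. same_type V \<sigma> \<tau>))"
proof -
  define pat where "pat \<tau> = {(u, v) \<in> V \<times> V. \<tau> u = \<tau> v}" for \<tau> :: valuation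
  have fin: "finite (V \<times> V)" using assms by simp
  from finite_list[OF this] obtain uvs where uvs: "set uvs = V \<times> V" ..
  have "finite (pat ` T)"
    by (rule finite_subset[of _ "Pow (V \<times> V)"]) (use fin in \<open>auto simp: pat_def\<close>)
  from finite_list[OF this] obtain Ps where Ps: "set Ps = pat ` T" ..
  define lit where "lit P uv = (let e = Eq (fst uv) (snd uv) in if uv \<in> P then e else Neg e)" for P uv
  define \<psi> where "\<psi> = disj_list (map (\<lambda>P. conj_list (map (lit P) uvs)) Ps)"
  have "fv_fm (lit P uv) = {fst uv, snd uv}" for P uv by (simp add: lit_def Let_def)
  then have "fv_fm \<psi> \<subseteq> (\<Union>uv\<in>set uvs. {fst uv, snd uv})" by (simp add: \<psi>_def)
  then have "fv_fm \<psi> \<subseteq> V" unfolding uvs by fastforce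
  moreover have "sat \<sigma> \<psi> \<longleftrightarrow> (\<exists>\<tau>\<in>T. same_type V \<sigma> \<tau>)" for \<sigma>
  proof -
    have "sat \<sigma> (lit P (u, v)) \<longleftrightarrow> (\<sigma> u = \<sigma> v \<longleftrightarrow> (u, v) \<in> P)" for P u v
      by (simp add: lit_def Let_def)
    then have "sat \<sigma> (conj_list (map (lit P) uvs)) \<longleftrightarrow>
        (\<forall>u\<in>V. \<forall>v\<in>V. \<sigma> u = \<sigma> v \<longleftrightarrow> (u, v) \<in> P)" for P
      by (simp add: uvs)
    then have "sat \<sigma> \<psi> \<longleftrightarrow> (\<exists>\<tau>\<in>T. \<forall>u\<in>V. \<forall>v\<in>V. \<sigma> u = \<sigma> v \<longleftrightarrow> (u, v) \<in> pat \<tau>)"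
      by (simp add: \<psi>_def Ps)
    then show ?thesis by (simp add: same_type_def pat_def)
  qed
  ultimately show ?thesis by blast
qed


section \<open>Facts about a computation\<close>

instance recf :: countable by countable_datatype

primrec subterms :: "recf \<Rightarrow> recf set" where
  "subterms Zero = {Zero}"
| "subterms Succ = {Succ}"
| "subterms (Proj i) = {Proj i}"
| "subterms (Comp f gs) = insert (Comp f gs) (subterms f \<union> \<Union>(set (map subterms gs)))"
| "subterms (PrimRec f g) = insert (PrimRec f g) (subterms f \<union> subterms g)"
| "subterms (Mu f) = insert (Mu f) (subterms f)"

lemma finite_subterms: "finite (subterms f)"
  by (induction f) auto

lemma self_in_subterms [simp]: "f \<in> subterms f"
  by (cases f) auto

lemma subterms_trans: "f \<in> subterms g \<Longrightarrow> subterms f \<subseteq> subterms g"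
proof (induction g)
  case (Comp h hs)
  from Comp.prems consider "f = Comp h hs" | "f \<in> subterms h" | h' where "h' \<in> set hs" "f \<in> subterms h'"
    by auto
  then show ?case
  proof cases
    case 3
    then have "subterms f \<subseteq> subterms h'" by (rule Comp.IH(2))
    then show ?thesis using 3(1) by auto
  qed (use Comp.IH in auto)
qed auto

text \<open>\<open>Val f cs c\<close> says that \<open>f\<close> maps the coordinates \<open>cs\<close> to the coordinate \<open>c\<close>, and \<open>Below f c cs\<close>
  that \<open>f\<close> has positive values at all \<open>m\<close> below the coordinate \<open>c\<close>; the latter makes the rule for
  \<open>Mu\<close> a sequence of local steps.\<close>

datatype 'c fact = Val recf "'c list" 'c | Below recf 'c "'c list"

datatype 'c slot = X 'c | S 'c | T "'c fact"

datatype marked_slot = Cur "nat slot" | Nxt "nat slot"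

instance fact :: (countable) countable by countable_datatype
instance slot :: (countable) countable by countable_datatype
instance marked_slot :: countable by countable_datatype

primrec holds :: "nat fact \<Rightarrow> bool" where
  "holds (Val f xs y) \<longleftrightarrow> computes f xs y"
| "holds (Below f y xs) \<longleftrightarrow> (\<forall>m<y. \<exists>k. computes f (m # xs) (Suc k))"

primrec val :: "nat slot \<Rightarrow> atom" where
  "val (X k) = k"
| "val (S k) = Suc k"
| "val (T b) = (if holds b then 0 else 1)"

text \<open>The cell with coordinates \<open>x\<close> consists of the coordinates (\<open>X\<close>), their successors (\<open>S\<close>), and the
  truth values of facts (\<open>T\<close>), where only the atom \<open>0\<close> stands for true. Slots marked \<open>Nxt\<close> belong to the cell
  obtained by increasing coordinate \<open>0\<close>. Slots are odd variables, constants are even ones: \<open>0\<close> is the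
  input, and \<open>2 * i + 2\<close> is the numeral \<open>i\<close>.\<close>

definition var_of :: "marked_slot \<Rightarrow> var" where
  "var_of s = 2 * to_nat s + 1"

lemma var_of_inject [simp]: "var_of s = var_of t \<longleftrightarrow> s = t"
  by (simp add: var_of_def)

lemma odd_var_of: "odd (var_of s)"
  by (simp add: var_of_def)

lemma even_neq_var_of: "even v \<Longrightarrow> v \<noteq> var_of s" "even v \<Longrightarrow> var_of s \<noteq> v"
  using odd_var_of by auto

abbreviation cur :: "nat slot \<Rightarrow> var" where
  "cur p \<equiv> var_of (Cur p)"

text \<open>Pins down the first \<open>n\<close> successors in coordinate \<open>0\<close>. The base
  case is a tautology whose free variable is the numeral \<open>0\<close>; the recursive form lets
  the code be computed from \<open>n\<close>.\<close>

primrec chain :: "nat \<Rightarrow> fm" where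
  "chain 0 = Eq 2 2"
| "chain (Suc i) = Conj (chain i)
     (Disj (Neg (Eq (cur (X 0)) (2 * i + 2))) (Eq (cur (S 0)) (2 * i + 4)))"

lemma sat_chain: "sat \<sigma> (chain n) \<longleftrightarrow> (\<forall>i<n. \<sigma> (cur (X 0)) = \<sigma> (2 * i + 2) \<longrightarrow> \<sigma> (cur (S 0)) = \<sigma> (2 * i + 4))"
  by (induction n) (auto simp: less_Suc_eq)

lemma fv_chain: "fv_fm (chain n) - {cur (X 0), cur (S 0)} = (\<lambda>i. 2 * i + 2) ` {..n}"
proof (induction n)
  case 0
  show ?case using even_neq_var_of[of 2] by auto
next
  case (Suc n)
  note neq = even_neq_var_of[of "2 * n + 2"] even_neq_var_of[of "2 * n + 4"]
  have "fv_fm (chain (Suc n)) - {cur (X 0), cur (S 0)}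
      = (fv_fm (chain n) - {cur (X 0), cur (S 0)}) \<union> {2 * n + 2, 2 * n + 4}"
    using neq by (auto simp del: add_2_eq_Suc')
  then show ?case using Suc by (auto simp: atMost_Suc)
qed

primrec chain_vals :: "nat \<Rightarrow> (var \<times> atom) list" where
  "chain_vals 0 = [(2, 0)]"
| "chain_vals (Suc i) = (2 * i + 4, Suc i) # chain_vals i"

definition const_vals :: "nat \<Rightarrow> (var \<times> atom) list" where
  "const_vals n = (0, n) # chain_vals n"

lemma set_chain_vals: "set (chain_vals n) = (\<lambda>i. (2 * i + 2, i)) ` {..n}"
  by (induction n) (auto simp: atMost_Suc)

lemma distinct_const_vals: "distinct (map fst (const_vals n))"
proof -
  have "distinct (map fst (chain_vals n))"
    by (induction n) (auto simp: set_chain_vals)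
  then show ?thesis by (auto simp: const_vals_def set_chain_vals)
qed

lemma fst_const_vals: "set (map fst (const_vals n)) = insert 0 ((\<lambda>i. 2 * i + 2) ` {..n})"
  by (simp add: const_vals_def set_chain_vals image_image)

lemma valuation_of_const_vals [simp]:
  "valuation_of (const_vals n) 0 = n"
  "i \<le> n \<Longrightarrow> valuation_of (const_vals n) (2 * i + 2) = i"
proof -
  show "valuation_of (const_vals n) 0 = n" by (simp add: valuation_of_def const_vals_def)
  assume "i \<le> n"
  then have "(2 * i + 2, i) \<in> set (const_vals n)" by (auto simp: const_vals_def set_chain_vals)
  then have "map_of (const_vals n) (2 * i + 2) = Some i"
    using distinct_const_vals by (rule map_of_is_SomeI[rotated])
  then show "valuation_of (const_vals n) (2 * i + 2) = i" by (simp add: valuation_of_def)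
qed


section \<open>The instance for a fixed recursive function\<close>

locale machine =
  fixes g :: recf
begin

text \<open>Derivations maintain \<open>length cs + size f \<le> L\<close>, with equality for
  \<open>g\<close> applied to one argument. \<open>K\<close> leaves room for up to \<open>L\<close>
  arguments, a value, and either \<open>L\<close> intermediate values of a composition or three
  auxiliary coordinates.\<close>

definition L :: nat where "L = Suc (size g)"
definition K :: nat where "K = 2 * L + 5"

definition facts :: "nat fact set" where
  "facts = {Val f cs c | f cs c. f \<in> subterms g \<and> set cs \<subseteq> {..<K} \<and> length cs \<le> L \<and> c < K} \<union>
     {Below f c cs | f c cs. f \<in> subterms g \<and> set cs \<subseteq> {..<K} \<and> length cs \<le> L \<and> c < K}"

lemma finite_facts: "finite facts"
proof -
  let ?P = "subterms g \<times> {cs. set cs \<subseteq> {..<K} \<and> length cs \<le> L} \<times> {..<K}"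
  have "finite ?P" by (simp add: finite_subterms finite_lists_length_le)
  moreover have "facts = (\<lambda>(f, cs, c). Val f cs c) ` ?P \<union> (\<lambda>(f, cs, c). Below f c cs) ` ?P"
    by (auto simp: facts_def image_iff)
  ultimately show ?thesis by simp
qed

definition Slots :: "nat slot set" where
  "Slots = X ` {..<K} \<union> S ` {..<K} \<union> T ` facts"

lemma in_Slots [simp]:
  "X k \<in> Slots \<longleftrightarrow> k < K" "S k \<in> Slots \<longleftrightarrow> k < K" "T b \<in> Slots \<longleftrightarrow> b \<in> facts"
  by (auto simp: Slots_def)

lemma finite_Slots: "finite Slots"
  by (simp add: Slots_def finite_facts)

lemma K_gt: "1 < K" by (simp add: K_def)

lemma set_fact_facts: "b \<in> facts \<Longrightarrow> set_fact b \<subseteq> {..<K}"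
  by (auto simp: facts_def)

lemma set_slot_Slots: "p \<in> Slots \<Longrightarrow> set_slot p \<subseteq> {..<K}"
  using set_fact_facts by (cases p) auto

lemma map_slot_in_Slots:
  assumes "p \<in> Slots" "\<And>j. j < K \<Longrightarrow> h j < K"
  shows "map_slot h p \<in> Slots"
  using assms by (cases p) (auto simp: facts_def subset_iff)

definition slots :: "nat slot list" where
  "slots = (SOME ps. distinct ps \<and> set ps = Slots)"

lemma slots [simp]: "distinct slots" "set slots = Slots"
proof -
  have "distinct slots \<and> set slots = Slots"
    unfolding slots_def by (rule someI_ex) (metis finite_distinct_list finite_Slots)
  then show "distinct slots" "set slots = Slots" by auto
qed

text \<open>Rotating the coordinates and increasing coordinate \<open>0\<close> together generate all moves on
  \<open>\<nat>\<^sup>K\<close>. The lists \<open>ps\<close> and \<open>us\<close> read off the cells reached by these two moves.\<close>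

definition rot :: "nat \<Rightarrow> nat" where
  "rot j = Suc j mod K"

text \<open>A slot that does not mention coordinate \<open>0\<close> is copied from the current
  cell; this is what makes a fact independent of the coordinates outside it. The new coordinate is
  the old \<open>S 0\<close>.\<close>

definition nxt :: "nat slot \<Rightarrow> marked_slot" where
  "nxt p = (if p = X 0 then Cur (S 0) else if 0 \<in> set_slot p then Nxt p else Cur p)"

definition zs :: "var list" where "zs = map cur slots @ map (var_of \<circ> Nxt) slots"
definition rs :: "var list" where "rs = map (cur \<circ> X) [0..<K]"
definition ws :: "var list" where "ws = map cur slots"
definition ps :: "var list" where "ps = map (cur \<circ> map_slot rot) slots"
definition us :: "var list" where "us = map (var_of \<circ> nxt) slots"

definition core_vars :: "var set" where
  "core_vars = insert 2 (cur ` Slots)"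

text \<open>A cell is admissible if it satisfies the same equalities as some cell of the standard model.\<close>

definition standard :: "valuation set" where
  "standard = {\<tau>. \<tau> 2 = 0 \<and> (\<exists>x. \<forall>p\<in>Slots. \<tau> (cur p) = val (map_slot x p))}"

text \<open>The choice is not effective, as \<open>standard\<close> depends on which facts are true.
  This is harmless: for fixed \<open>g\<close> the formula is a constant of the reduction.\<close>

definition core :: fm where
  "core = (SOME \<psi>. fv_fm \<psi> \<subseteq> core_vars \<and>
     (\<forall>\<sigma>. sat \<sigma> \<psi> \<longleftrightarrow> (\<exists>\<tau>\<in>standard. same_type core_vars \<sigma> \<tau>)))"

lemma core:
  "fv_fm core \<subseteq> core_vars"
  "sat \<sigma> core \<longleftrightarrow> (\<exists>\<tau>\<in>standard. same_type core_vars \<sigma> \<tau>)"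
proof -
  have "finite core_vars" by (simp add: core_vars_def finite_Slots)
  note core = someI_ex[OF ex_type_formula[OF this, of standard], folded core_def]
  show "fv_fm core \<subseteq> core_vars" using core by (rule conjunct1)
  show "sat \<sigma> core \<longleftrightarrow> (\<exists>\<tau>\<in>standard. same_type core_vars \<sigma> \<tau>)" using core by blast
qed

text \<open>The negated part forbids a cell that has the input in coordinate \<open>0\<close> and
  records coordinate \<open>1\<close> as the value of \<open>g\<close> there. The input enters only
  as variable \<open>0\<close>, so the formula is the same for all inputs.\<close>

definition base :: fm where
  "base = Conj core (Neg (Conj (Eq (cur (X 0)) 0) (Eq (cur (T (Val g [0] 1))) 2)))"

definition \<phi> :: "nat \<Rightarrow> fm" where
  "\<phi> n = Conj base (chain n)"

lemma goal_in_facts [simp]: "Val g [0] (Suc 0) \<in> facts"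
  using K_gt by (auto simp: facts_def L_def)

lemma set_zs: "set zs = var_of ` (Cur ` Slots \<union> Nxt ` Slots)"
  by (auto simp: zs_def image_image)

lemma nxt_in: "p \<in> Slots \<Longrightarrow> nxt p \<in> Cur ` Slots \<union> Nxt ` Slots"
  using K_gt by (auto simp: nxt_def)

lemma rot_less: "rot j < K"
  using K_gt by (simp add: rot_def)

lemma card_Slots: "length slots = card Slots"
  using distinct_card[OF slots(1)] by simp

lemma K_less_slots: "K < length slots"
proof -
  have "X ` {..<K} \<subset> Slots" using K_gt by (auto simp: Slots_def)
  then have "card (X ` {..<K}) < card Slots" by (rule psubset_card_mono[OF finite_Slots])
  then show ?thesis by (simp add: card_Slots card_image inj_on_def)
qed

lemma fv_\<phi>: "fv_fm (\<phi> n) - set zs = set (map fst (const_vals n))"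
proof -
  have odd: "v \<notin> set zs" if "even v" for v
    using that odd_var_of by (auto simp: set_zs)
  have inz: "cur p \<in> set zs" if "p \<in> Slots" for p using that by (auto simp: set_zs)
  have "fv_fm (chain n) - set zs = (\<lambda>i. 2 * i + 2) ` {..n}"
  proof -
    have "fv_fm (chain n) - set zs = (fv_fm (chain n) - {cur (X 0), cur (S 0)}) - set zs"
      using inz K_gt by auto
    also have "\<dots> = (\<lambda>i. 2 * i + 2) ` {..n} - set zs" by (simp only: fv_chain)
    also have "\<dots> = (\<lambda>i. 2 * i + 2) ` {..n}"
    proof (rule Diff_triv, rule equals0I)
      fix v assume "v \<in> (\<lambda>i. 2 * i + 2) ` {..n} \<inter> set zs"
      then have "even v" "v \<in> set zs" by auto
      with odd show False by blast
    qed
    finally show ?thesis .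
  qed
  moreover have "fv_fm base - set zs = {0, 2}"
  proof -
    have "fv_fm core - set zs \<subseteq> {2}" using core(1) by (auto simp: core_vars_def set_zs)
    moreover have "cur (X 0) \<in> set zs" using inz K_gt by simp
    moreover have "cur (T (Val g [0] 1)) \<in> set zs" by (rule inz) simp
    moreover have "0 \<notin> set zs" "2 \<notin> set zs" using odd by simp_all
    moreover have "fv_fm base = fv_fm core \<union> {cur (X 0), 0, cur (T (Val g [0] 1)), 2}"
      by (simp add: base_def insert_commute)
    ultimately show ?thesis by blast
  qed
  moreover have "2 \<in> (\<lambda>i. 2 * i + 2) ` {..n}" by (rule image_eqI[of _ _ 0]) auto
  ultimately show ?thesis unfolding \<phi>_def fst_const_vals by auto
qed

lemma distinct_zs: "distinct zs"
proof -
  have "inj_on cur Slots" "inj_on (var_of \<circ> Nxt) Slots" by (simp_all add: inj_on_def)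
  moreover have "cur ` Slots \<inter> (var_of \<circ> Nxt) ` Slots = {}" by auto
  ultimately show ?thesis by (simp add: zs_def distinct_map)
qed

lemma subs: "set rs \<subseteq> set ws" "set ws \<subseteq> set zs" "set ps \<subseteq> set zs" "set us \<subseteq> set zs"
proof -
  show "set rs \<subseteq> set ws" by (auto simp: rs_def ws_def)
  show "set ws \<subseteq> set zs" by (auto simp: ws_def zs_def)
  show "set ps \<subseteq> set zs"
    using map_slot_in_Slots[OF _ rot_less] by (auto simp: ps_def set_zs)
  show "set us \<subseteq> set zs"
    using nxt_in by (auto simp: us_def set_zs)
qed

lemma lens: "length ps = length ws" "length us = length ws"
  "1 < length rs" "length rs < length ws" "length ws < length zs"
proof -
  have "0 < length slots" using K_less_slots by linarith
  then show "length ps = length ws" "length us = length ws"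
    "1 < length rs" "length rs < length ws" "length ws < length zs"
    using K_less_slots K_gt by (simp_all add: ps_def us_def ws_def rs_def zs_def)
qed

lemma matching_gadget: "matching_gadget zs rs ws ps us (\<phi> n) (const_vals n)"
  by (intro matching_gadget.intro distinct_zs subs lens distinct_const_vals fv_\<phi>[symmetric])

sublocale gadget: matching_gadget zs rs ws ps us "\<phi> n" "const_vals n" for n
  by (rule matching_gadget)

end


section \<open>Consistent fillings of the grid\<close>

lemma map_slot_comp: "map_slot f (map_slot h p) = map_slot (\<lambda>j. f (h j)) p"
  by (simp add: slot.map_comp comp_def)

text \<open>The atoms in the \<open>S\<close> slots are constrained only through \<phi> and the
  moves; arithmetic has to be recovered from equalities between atoms.\<close>

locale solution = machine +
  fixes n :: nat and Z :: "valuation set"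
  assumes const: "\<tau> \<in> Z \<Longrightarrow> \<tau> 0 = n" "\<tau> \<in> Z \<Longrightarrow> i \<le> n \<Longrightarrow> \<tau> (2 * i + 2) = i"
    and sat: "\<tau> \<in> Z \<Longrightarrow> sat \<tau> (\<phi> n)"
    and ex_root: "\<exists>\<tau>\<in>Z. \<forall>k<K. \<tau> (cur (X k)) = \<xi> k"
    and unique: "\<tau> \<in> Z \<Longrightarrow> \<tau>' \<in> Z \<Longrightarrow> (\<And>k. k < K \<Longrightarrow> \<tau> (cur (X k)) = \<tau>' (cur (X k))) \<Longrightarrow> \<tau> = \<tau>'"
    and rotate: "\<tau> \<in> Z \<Longrightarrow> \<exists>\<tau>'\<in>Z. \<forall>p\<in>Slots. \<tau>' (cur p) = \<tau> (cur (map_slot rot p))"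
    and next0: "\<tau> \<in> Z \<Longrightarrow> \<exists>\<tau>'\<in>Z. \<forall>p\<in>Slots. \<tau>' (cur p) = \<tau> (var_of (nxt p))"
begin

lemma K_pos: "0 < K" using K_gt by simp

lemma zero: "\<tau> \<in> Z \<Longrightarrow> \<tau> 2 = 0"
  using const(2)[of \<tau> 0] by (simp add: numeral_2_eq_2)

lemma rotate_iter:
  assumes "\<tau> \<in> Z"
  shows "\<exists>\<tau>'\<in>Z. \<forall>p\<in>Slots. \<tau>' (cur p) = \<tau> (cur (map_slot (\<lambda>j. (j + i) mod K) p))"
proof (induction i)
  case 0
  have "map_slot (\<lambda>j. (j + 0) mod K) p = p" if "p \<in> Slots" for p
    using set_slot_Slots[OF that] by (intro slot.map_ident_strong) auto
  then show ?case using assms by auto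
next
  case (Suc i)
  then obtain \<tau>1 where 1: "\<tau>1 \<in> Z" "\<forall>p\<in>Slots. \<tau>1 (cur p) = \<tau> (cur (map_slot (\<lambda>j. (j + i) mod K) p))" ..
  from rotate[OF 1(1)] obtain \<tau>2 where 2: "\<tau>2 \<in> Z" "\<forall>p\<in>Slots. \<tau>2 (cur p) = \<tau>1 (cur (map_slot rot p))" ..
  have "\<tau>2 (cur p) = \<tau> (cur (map_slot (\<lambda>j. (j + Suc i) mod K) p))" if p: "p \<in> Slots" for p
  proof -
    have "map_slot rot p \<in> Slots" using p rot_less by (rule map_slot_in_Slots)
    then have "\<tau>2 (cur p) = \<tau> (cur (map_slot (\<lambda>j. (j + i) mod K) (map_slot rot p)))"
      using 1 2 p by simp
    also have "map_slot (\<lambda>j. (j + i) mod K) (map_slot rot p) = map_slot (\<lambda>j. (j + Suc i) mod K) p"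
      by (simp add: map_slot_comp rot_def mod_add_left_eq)
    finally show ?thesis .
  qed
  with 2 show ?case by blast
qed

text \<open>Rotating by \<open>k\<close> brings coordinate \<open>k\<close> to position
  \<open>0\<close>, where \<open>next0\<close> applies, and rotating by \<open>K - k\<close>
  completes the cycle. A slot without \<open>k\<close> becomes one without \<open>0\<close> and
  survives.\<close>

lemma increment:
  assumes \<tau>: "\<tau> \<in> Z" and k: "k < K"
  shows "\<exists>\<tau>'\<in>Z. \<tau>' (cur (X k)) = \<tau> (cur (S k)) \<and>
    (\<forall>p\<in>Slots. k \<notin> set_slot p \<longrightarrow> \<tau>' (cur p) = \<tau> (cur p))"
proof -
  let ?r = "\<lambda>i j. (j + i) mod K"
  obtain \<tau>1 where 1: "\<tau>1 \<in> Z" "\<forall>p\<in>Slots. \<tau>1 (cur p) = \<tau> (cur (map_slot (?r k) p))"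
    using rotate_iter[OF \<tau>, of k] by blast
  obtain \<tau>2 where 2: "\<tau>2 \<in> Z" "\<forall>p\<in>Slots. \<tau>2 (cur p) = \<tau>1 (var_of (nxt p))"
    using next0[OF 1(1)] by blast
  obtain \<tau>3 where 3: "\<tau>3 \<in> Z" "\<forall>p\<in>Slots. \<tau>3 (cur p) = \<tau>2 (cur (map_slot (?r (K - k)) p))"
    using rotate_iter[OF 2(1), of "K - k"] by blast
  have in_Slots': "map_slot (?r i) p \<in> Slots" if "p \<in> Slots" for i p
    using that K_pos by (rule_tac map_slot_in_Slots) auto
  have "\<tau>3 (cur (X k)) = \<tau> (cur (S k))"
  proof -
    have "\<tau>3 (cur (X k)) = \<tau>2 (cur (X 0))" using 3 k by simp
    also have "\<dots> = \<tau>1 (cur (S 0))" using 2 K_pos by (simp add: nxt_def)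
    also have "\<dots> = \<tau> (cur (S k))" using 1 K_pos k by simp
    finally show ?thesis .
  qed
  moreover have "\<tau>3 (cur p) = \<tau> (cur p)" if p: "p \<in> Slots" "k \<notin> set_slot p" for p
  proof -
    define q where "q = map_slot (?r (K - k)) p"
    have q: "q \<in> Slots" using in_Slots'[OF p(1)] by (simp add: q_def)
    have nz: "?r (K - k) j \<noteq> 0" if "j \<in> set_slot p" for j
    proof
      assume 0: "?r (K - k) j = 0"
      have j: "j < K" "j \<noteq> k" using set_slot_Slots[OF p(1)] that p(2) by auto
      from 0 obtain m where m: "j + (K - k) = K * m" by (auto simp: mod_eq_0_iff_dvd elim: dvdE)
      have "m = 1"
      proof -
        have "0 < K * m" "K * m < K * 2" unfolding m[symmetric] using j k by linarith+
        then show ?thesis by auto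
      qed
      with m j k show False by simp
    qed
    have "0 \<notin> set_slot q"
    proof
      assume "0 \<in> set_slot q"
      then obtain j where "0 = ?r (K - k) j" "j \<in> set_slot p"
        unfolding q_def slot.set_map by (rule imageE)
      with nz show False by metis
    qed
    then have "\<tau>2 (cur q) = \<tau>1 (cur q)" using 2 q by (auto simp: nxt_def)
    also have "\<dots> = \<tau> (cur (map_slot (?r k) q))" using 1 q by simp
    also have "map_slot (?r k) q = p" unfolding q_def map_slot_comp
    proof (rule slot.map_ident_strong)
      fix j assume "j \<in> set_slot p"
      then have "j < K" using set_slot_Slots[OF p(1)] by auto
      then show "((j + (K - k)) mod K + k) mod K = j" using k by (simp add: mod_add_left_eq)
    qed
    finally show ?thesis using 3 p by (simp add: q_def)
  qed
  ultimately show ?thesis using 3(1) by blast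
qed

section \<open>A copy of the grid inside the solution\<close>

definition cell :: "(nat \<Rightarrow> atom) \<Rightarrow> valuation" where
  "cell \<xi> = (SOME \<tau>. \<tau> \<in> Z \<and> (\<forall>k<K. \<tau> (cur (X k)) = \<xi> k))"

lemma cell: "cell \<xi> \<in> Z" "k < K \<Longrightarrow> cell \<xi> (cur (X k)) = \<xi> k"
proof -
  have "\<exists>\<tau>. \<tau> \<in> Z \<and> (\<forall>k<K. \<tau> (cur (X k)) = \<xi> k)" using ex_root by blast
  from someI_ex[OF this, folded cell_def]
  show "cell \<xi> \<in> Z" "k < K \<Longrightarrow> cell \<xi> (cur (X k)) = \<xi> k" by auto
qed

lemma cell_eqI: "\<tau> \<in> Z \<Longrightarrow> (\<And>k. k < K \<Longrightarrow> \<tau> (cur (X k)) = \<xi> k) \<Longrightarrow> cell \<xi> = \<tau>"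
  by (rule unique) (auto simp: cell)

lemma cell_cong: "(\<And>k. k < K \<Longrightarrow> \<xi> k = \<xi>' k) \<Longrightarrow> cell \<xi> = cell \<xi>'"
  by (rule unique) (auto simp: cell)

text \<open>At first each coordinate has its own copy \<open>axis k\<close> of the natural numbers inside the atoms;
  they turn out to agree because equal coordinates have equal successors.\<close>

primrec axis :: "nat \<Rightarrow> nat \<Rightarrow> atom" where
  "axis k 0 = 0"
| "axis k (Suc i) = cell (\<lambda>j. if j = k then axis k i else 0) (cur (S k))"

definition grid :: "(nat \<Rightarrow> nat) \<Rightarrow> valuation" where
  "grid x = cell (\<lambda>j. axis j (x j))"

lemma grid: "grid x \<in> Z" "k < K \<Longrightarrow> grid x (cur (X k)) = axis k (x k)"
  by (auto simp: grid_def cell)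

lemma grid_cong: "(\<And>k. k < K \<Longrightarrow> x k = y k) \<Longrightarrow> grid x = grid y"
  unfolding grid_def by (rule cell_cong) simp

text \<open>\<open>increment\<close> moves coordinate \<open>k\<close> to whatever atom
  \<open>S k\<close> holds; the hypothesis on \<open>S k\<close> ensures that this is the next grid
  point.\<close>

lemma grid_step:
  assumes k: "k < K" and S: "grid y (cur (S k)) = axis k (Suc (y k))"
    and p: "p \<in> Slots" "k \<notin> set_slot p"
  shows "grid (y(k := Suc (y k))) (cur p) = grid y (cur p)"
proof -
  obtain \<tau> where \<tau>: "\<tau> \<in> Z" "\<tau> (cur (X k)) = grid y (cur (S k))"
    "\<forall>p\<in>Slots. k \<notin> set_slot p \<longrightarrow> \<tau> (cur p) = grid y (cur p)"
    using increment[OF grid(1) k] by blast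
  have "grid (y(k := Suc (y k))) = \<tau>"
    unfolding grid_def
  proof (rule cell_eqI)
    fix j assume j: "j < K"
    show "\<tau> (cur (X j)) = axis j ((y(k := Suc (y k))) j)"
    proof (cases "j = k")
      case True
      then show ?thesis using \<tau> S by simp
    next
      case False
      then have "\<tau> (cur (X j)) = grid y (cur (X j))" using \<tau>(3) j by simp
      then show ?thesis using False j by (simp add: grid)
    qed
  qed (rule \<tau>)
  then show ?thesis using \<tau> p by simp
qed

text \<open>On the axis through \<open>j\<close> this is the definition. Elsewhere another
  coordinate \<open>k\<close> is nonzero, and lowering it by one does not affect \<open>S j\<close>.
  That step needs the claim for \<open>S k\<close> at the smaller point, so the induction covers all
  coordinates at once.\<close>

lemma grid_S_axis: "j < K \<Longrightarrow> grid x (cur (S j)) = axis j (Suc (x j))"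
proof (induction "\<Sum>k<K. x k" arbitrary: x j rule: less_induct)
  case less
  show ?case
  proof (cases "\<exists>k<K. k \<noteq> j \<and> x k \<noteq> 0")
    case False
    then have "grid x = cell (\<lambda>i. if i = j then axis j (x j) else 0)"
      unfolding grid_def by (intro cell_cong) auto
    then show ?thesis by simp
  next
    case True
    then obtain k m where k: "k < K" "k \<noteq> j" "x k = Suc m" by (auto simp: gr0_conv_Suc)
    define y where "y = x(k := m)"
    have sum: "(\<Sum>i<K. y i) < (\<Sum>i<K. x i)"
      by (rule sum_strict_mono_ex1) (use k in \<open>auto simp: y_def\<close>)
    have x: "x = y(k := Suc (y k))" using k by (auto simp: y_def)
    have "grid x (cur (S j)) = grid y (cur (S j))"
      unfolding x by (rule grid_step) (use k less.prems less.hyps[OF sum] in auto)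
    also have "\<dots> = axis j (Suc (y j))" using less.hyps[OF sum] less.prems by simp
    finally show ?thesis using k by (simp add: y_def)
  qed
qed

lemma grid_core:
  "\<exists>y. (\<forall>p\<in>Slots. \<forall>q\<in>Slots. grid x (cur p) = grid x (cur q) \<longleftrightarrow> val (map_slot y p) = val (map_slot y q)) \<and>
     (\<forall>p\<in>Slots. grid x (cur p) = 0 \<longleftrightarrow> val (map_slot y p) = 0)"
proof -
  have "sat (grid x) core" using sat[OF grid(1)[of x]] by (simp add: \<phi>_def base_def)
  then obtain \<tau> y where \<tau>: "same_type core_vars (grid x) \<tau>" "\<tau> 2 = 0"
    and y: "\<forall>p\<in>Slots. \<tau> (cur p) = val (map_slot y p)"
    by (auto simp: core(2) standard_def)
  have *: "grid x u = grid x v \<longleftrightarrow> \<tau> u = \<tau> v" if "u \<in> core_vars" "v \<in> core_vars" for u v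
    using \<tau>(1) that by (simp add: same_type_def)
  have "grid x 2 = 0" using zero grid(1) by simp
  then have "grid x (cur p) = 0 \<longleftrightarrow> val (map_slot y p) = 0" if "p \<in> Slots" for p
    using *[of "cur p" 2] \<tau>(2) y that by (simp add: core_vars_def)
  moreover have "grid x (cur p) = grid x (cur q) \<longleftrightarrow> val (map_slot y p) = val (map_slot y q)"
    if "p \<in> Slots" "q \<in> Slots" for p q
    using *[of "cur p" "cur q"] y that by (simp add: core_vars_def)
  ultimately show ?thesis by blast
qed

lemma axis_eq: "j < K \<Longrightarrow> axis j i = axis 0 i"
proof (induction i)
  case (Suc i)
  \<comment> \<open>At this diagonal point the coordinates \<open>j\<close> and \<open>0\<close> are
    equal atoms by induction, so they have equal successors in a standard cell of the same equality
    type.\<close>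
  let ?x = "\<lambda>_. i"
  obtain y where "\<forall>p\<in>Slots. \<forall>q\<in>Slots. grid ?x (cur p) = grid ?x (cur q) \<longleftrightarrow> val (map_slot y p) = val (map_slot y q)"
    using grid_core by blast
  then have "grid ?x (cur (X j)) = grid ?x (cur (X 0)) \<longleftrightarrow> y j = y 0"
    "grid ?x (cur (S j)) = grid ?x (cur (S 0)) \<longleftrightarrow> Suc (y j) = Suc (y 0)"
    using Suc.prems K_pos by auto
  then have "grid ?x (cur (S j)) = grid ?x (cur (S 0))"
    using Suc K_pos by (simp add: grid(2))
  then show ?case using Suc.prems K_pos by (simp only: grid_S_axis)
qed simp

lemma grid_X: "k < K \<Longrightarrow> grid x (cur (X k)) = axis 0 (x k)"
  using axis_eq[of k "x k"] by (simp only: grid(2))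

lemma grid_S: "k < K \<Longrightarrow> grid x (cur (S k)) = axis 0 (Suc (x k))"
  using axis_eq[of k "Suc (x k)"] by (simp only: grid_S_axis)

text \<open>Locates the input on the grid. Beyond \<open>n\<close> no relation between positions and
  atoms is claimed.\<close>

lemma axis_const: "i \<le> n \<Longrightarrow> axis 0 i = i"
proof (induction i)
  case (Suc i)
  let ?x = "\<lambda>_. i"
  have "sat (grid ?x) (chain n)" using sat[OF grid(1)[of ?x]] by (simp add: \<phi>_def)
  then have "grid ?x (cur (X 0)) = grid ?x (2 * i + 2) \<longrightarrow> grid ?x (cur (S 0)) = grid ?x (2 * i + 4)"
    using Suc.prems by (simp add: sat_chain)
  moreover have "grid ?x (2 * i + 2) = i" using const(2)[OF grid(1)] Suc.prems by simp
  moreover have "2 * i + 4 = 2 * Suc i + 2" by simp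
  then have "grid ?x (2 * i + 4) = Suc i" using const(2)[OF grid(1)] Suc.prems by metis
  ultimately show ?case using Suc K_pos by (simp add: grid_X grid_S del: axis.simps)
qed simp

section \<open>Facts established by the solution\<close>

definition est :: "(nat \<Rightarrow> nat) \<Rightarrow> nat fact \<Rightarrow> bool" where
  "est x b \<longleftrightarrow> grid x (cur (T b)) = 0"

text \<open>A slot that does not mention \<open>k\<close> survives every increment of
  \<open>k\<close>, so all values of \<open>k\<close> give the same answer as
  \<open>0\<close>.\<close>

lemma est_upd:
  assumes "b \<in> facts" "k \<notin> set_fact b"
  shows "est (x(k := v)) b = est x b"
proof (cases "k < K")
  case True
  have zero: "est (x(k := v)) b = est (x(k := 0)) b" for v
  proof (induction v)
    case (Suc v)
    have "grid ((x(k := v))(k := Suc ((x(k := v)) k))) (cur (T b)) = grid (x(k := v)) (cur (T b))"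
      by (rule grid_step) (use True assms grid_S_axis in \<open>auto simp del: axis.simps\<close>)
    then have "est (x(k := Suc v)) b = est (x(k := v)) b"
      unfolding est_def by (simp only: fun_upd_upd fun_upd_same)
    then show ?case by (simp only: Suc)
  qed (rule refl)
  show ?thesis using zero[of v] zero[of "x k"] by simp
next
  case False
  then have "grid (x(k := v)) = grid x" by (intro grid_cong) auto
  then show ?thesis by (simp add: est_def)
qed

lemma est_cong:
  assumes b: "b \<in> facts" and eq: "\<And>k. k \<in> set_fact b \<Longrightarrow> x k = y k"
  shows "est x b = est y b"
proof -
  have "est (\<lambda>k. if k \<in> F then y k else x k) b = est x b" if "finite F" "F \<inter> set_fact b = {}" for F
    using that
  proof (induction F)
    case (insert j F)
    have "(\<lambda>k. if k \<in> insert j F then y k else x k) = (\<lambda>k. if k \<in> F then y k else x k)(j := y j)"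
      by auto
    then show ?case using insert est_upd[OF b, of j] by simp
  qed simp
  from this[of "{..<K} - set_fact b"]
  have "est x b = est (\<lambda>k. if k \<in> {..<K} - set_fact b then y k else x k) b" by auto
  also have "grid (\<lambda>k. if k \<in> {..<K} - set_fact b then y k else x k) = grid y"
    using eq by (intro grid_cong) auto
  then have "est (\<lambda>k. if k \<in> {..<K} - set_fact b then y k else x k) b = est y b"
    by (simp add: est_def)
  finally show ?thesis .
qed

text \<open>Whatever holds at all points \<open>y\<close> of the standard model that look like \<open>x\<close> is
  established at \<open>x\<close>; so the rules of \<open>computes\<close> can be applied to \<open>y\<close>.\<close>

lemma lookalike:
  obtains y where "\<And>j. j < K \<Longrightarrow> x j = 0 \<Longrightarrow> y j = 0"
    "\<And>j k. j < K \<Longrightarrow> k < K \<Longrightarrow> x j = x k \<Longrightarrow> y j = y k"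
    "\<And>j k. j < K \<Longrightarrow> k < K \<Longrightarrow> x j = Suc (x k) \<Longrightarrow> y j = Suc (y k)"
    "\<And>b. b \<in> facts \<Longrightarrow> est x b \<longleftrightarrow> holds (map_fact y b)"
proof -
  obtain y where y: "\<forall>p\<in>Slots. \<forall>q\<in>Slots. grid x (cur p) = grid x (cur q) \<longleftrightarrow> val (map_slot y p) = val (map_slot y q)"
     "\<forall>p\<in>Slots. grid x (cur p) = 0 \<longleftrightarrow> val (map_slot y p) = 0"
    using grid_core[of x] by blast
  show thesis
  proof (rule that[of y])
    show "y j = 0" if "j < K" "x j = 0" for j
      using y(2)[rule_format, of "X j"] that by (simp add: grid_X)
    show "y j = y k" if "j < K" "k < K" "x j = x k" for j k
      using y(1)[rule_format, of "X j" "X k"] that by (simp add: grid_X)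
    show "y j = Suc (y k)" if "j < K" "k < K" "x j = Suc (x k)" for j k
      using y(1)[rule_format, of "X j" "S k"] that by (simp add: grid_X grid_S del: axis.simps)
    show "est x b \<longleftrightarrow> holds (map_fact y b)" if "b \<in> facts" for b
      using y(2)[rule_format, of "T b"] that by (simp add: est_def split: if_splits)
  qed
qed

end


lemma length_le_size_list: "length xs \<le> size_list f xs"
  by (induction xs) auto

lemma member_le_size_list: "x \<in> set xs \<Longrightarrow> f x \<le> size_list f xs"
  by (induction xs) auto

context machine
begin

lemma in_facts:
  assumes "f \<in> subterms g" "length cs + size f \<le> L" "set cs \<subseteq> {..<K}" "c < K"
  shows "Val f cs c \<in> facts" "Below f c cs \<in> facts"
  using assms by (auto simp: facts_def)

lemma fresh_coordinates:
  assumes "finite F" "card F + m \<le> K"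
  obtains ds where "distinct ds" "length ds = m" "set ds \<subseteq> {..<K} - F"
proof -
  have "m \<le> card ({..<K} - F)"
    using diff_card_le_card_Diff[OF assms(1), of "{..<K}"] assms(2) by simp
  then obtain D where D: "D \<subseteq> {..<K} - F" "card D = m" "finite D"
    by (rule obtain_subset_with_card_n)
  from finite_distinct_list[OF D(3)] obtain ds where "set ds = D" "distinct ds" by blast
  then show thesis using D by (intro that[of ds]) (auto simp: distinct_card[symmetric])
qed

text \<open>A smaller argument, a value, and the predecessor of that value are the most that any
  rule other than composition needs.\<close>

lemma fresh3:
  assumes "length cs \<le> L" "c < K"
  obtains d r s where "d < K" "r < K" "s < K" "d \<notin> insert c (set cs)" "r \<notin> insert c (set cs)"
    "s \<notin> insert c (set cs)" "d \<noteq> r" "d \<noteq> s" "r \<noteq> s"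
proof -
  have "card (insert c (set cs)) \<le> Suc L"
    using card_length[of cs] assms(1) by (simp add: card_insert_if)
  then have "card (insert c (set cs)) + 3 \<le> K" by (simp add: K_def)
  then obtain ds where ds: "distinct ds" "length ds = 3" "set ds \<subseteq> {..<K} - insert c (set cs)"
    using fresh_coordinates[of "insert c (set cs)" 3] by blast
  then obtain d r s where "ds = [d, r, s]" by (auto simp: numeral_3_eq_3 length_Suc_conv)
  then show thesis using ds by (intro that[of d r s]) auto
qed

end

section \<open>Established facts are closed under the rules of \<open>computes\<close>\<close>

context solution
begin

text \<open>Allowing all positions \<open>cs\<close> and \<open>c\<close> lets a derivation move
  values to fresh coordinates; the size bound keeps the resulting facts within
  \<open>facts\<close>.\<close>

definition complete :: "recf \<Rightarrow> nat list \<Rightarrow> nat \<Rightarrow> bool" where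
  "complete f xs y \<longleftrightarrow> (\<forall>x cs c. f \<in> subterms g \<longrightarrow> length cs + size f \<le> L \<longrightarrow> set cs \<subseteq> {..<K} \<longrightarrow>
     c < K \<longrightarrow> map x cs = xs \<longrightarrow> x c = y \<longrightarrow> est x (Val f cs c))"

lemma completeD:
  assumes "complete f xs y" "f \<in> subterms g" "length cs + size f \<le> L" "set cs \<subseteq> {..<K}"
    "c < K" "map x cs = xs" "x c = y"
  shows "est x (Val f cs c)"
  using assms unfolding complete_def by blast

lemma completeI:
  assumes "\<And>x cs c. f \<in> subterms g \<Longrightarrow> length cs + size f \<le> L \<Longrightarrow> set cs \<subseteq> {..<K} \<Longrightarrow>
     c < K \<Longrightarrow> map x cs = xs \<Longrightarrow> x c = y \<Longrightarrow> est x (Val f cs c)"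
  shows "complete f xs y"
  using assms unfolding complete_def by blast

lemma est_Val_upd:
  assumes "est x' (Val f cs c)" "Val f cs c \<in> facts" "\<And>k. k \<in> insert c (set cs) \<Longrightarrow> x' k = x k"
  shows "est x (Val f cs c)"
  using est_cong[OF assms(2), of x' x] assms(1,3) by simp

text \<open>The intermediate values are written into fresh coordinates, so that all premises concern
  one cell. Its lookalike satisfies the premises, hence the conclusion, which transfers back because
  it does not mention the fresh coordinates. The other rules follow this pattern.\<close>

lemma complete_Comp:
  assumes gs: "list_all2 (\<lambda>h y. complete h xs y) gs ys" and f: "complete f ys z"
  shows "complete (Comp f gs) xs z"
proof (rule completeI)
  fix x cs c
  assume sub: "Comp f gs \<in> subterms g" and len: "length cs + size (Comp f gs) \<le> L"
    and cs: "set cs \<subseteq> {..<K}" "c < K" "map x cs = xs" "x c = z"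
  note fact = in_facts(1)[OF sub len cs(1,2)]
  have subs: "f \<in> subterms g" "\<And>h. h \<in> set gs \<Longrightarrow> h \<in> subterms g"
  proof -
    show "f \<in> subterms g" using subterms_trans[OF sub] by auto
    show "h \<in> subterms g" if "h \<in> set gs" for h
    proof -
      have "subterms h \<subseteq> subterms g" using subterms_trans[OF sub] that by auto
      then show ?thesis using self_in_subterms by blast
    qed
  qed
  have sizes: "length gs \<le> L" "length gs + size f \<le> L" "length cs \<le> L"
    "\<And>h. h \<in> set gs \<Longrightarrow> length cs + size h \<le> L"
    using len length_le_size_list[of gs size] member_le_size_list[of _ gs size] by fastforce+
  have len_ys: "length ys = length gs" using gs by (simp add: list_all2_lengthD)
  have "card (insert c (set cs)) \<le> Suc L"
    using card_length[of cs] sizes(3) by (simp add: card_insert_if)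
  then have "card (insert c (set cs)) + length gs \<le> K" using sizes(1) by (simp add: K_def)
  then obtain ds where ds: "distinct ds" "length ds = length gs" "set ds \<subseteq> {..<K} - insert c (set cs)"
    using fresh_coordinates[of "insert c (set cs)" "length gs"] by blast
  obtain x' where x': "x' \<in> variants x ds" "map x' ds = ys"
    using variant_of_list[OF ds(1), of ys x] ds(2) len_ys by auto
  have x'_eq: "x' k = x k" if "k \<in> insert c (set cs)" for k
    using x'(1) ds(3) that by (auto simp: variants_def)
  have "map x' cs = xs" "x' c = z" using x'_eq cs by auto
  have fds: "est x' (Val f ds c)" "Val f ds c \<in> facts"
  proof -
    have *: "length ds + size f \<le> L" "set ds \<subseteq> {..<K}" using sizes(2) ds by auto
    show "est x' (Val f ds c)" using completeD[OF f subs(1) *(1,2) cs(2) x'(2) \<open>x' c = z\<close>] .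
    show "Val f ds c \<in> facts" using in_facts(1)[OF subs(1) *(1,2) cs(2)] .
  qed
  have gds: "est x' (Val (gs ! i) cs (ds ! i))" "Val (gs ! i) cs (ds ! i) \<in> facts" if i: "i < length gs" for i
  proof -
    have "gs ! i \<in> set gs" "ds ! i \<in> set ds" using i ds(2) by auto
    then have *: "gs ! i \<in> subterms g" "length cs + size (gs ! i) \<le> L" "ds ! i < K"
      using subs sizes(4) ds(3) by auto
    have "complete (gs ! i) xs (ys ! i)" using gs i by (rule list_all2_nthD)
    moreover have "x' (ds ! i) = ys ! i" using x'(2) i ds(2) by auto
    ultimately show "est x' (Val (gs ! i) cs (ds ! i))"
      using * cs(1) \<open>map x' cs = xs\<close> by (intro completeD[of _ xs "ys ! i"])
    show "Val (gs ! i) cs (ds ! i) \<in> facts" by (rule in_facts) (use * cs(1) in auto)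
  qed
  obtain y where y: "\<And>b. b \<in> facts \<Longrightarrow> est x' b \<longleftrightarrow> holds (map_fact y b)"
    using lookalike[of x'] by metis
  have "list_all2 (\<lambda>h v. computes h (map y cs) v) gs (map y ds)"
    using gds y ds(2) by (force simp: list_all2_conv_all_nth)
  moreover have "computes f (map y ds) (y c)" using fds y by fastforce
  ultimately have "computes (Comp f gs) (map y cs) (y c)" by (rule computes.intros)
  then have "est x' (Val (Comp f gs) cs c)" using y[OF fact] by simp
  then show "est x (Val (Comp f gs) cs c)" using fact x'_eq by (rule est_Val_upd)
qed

lemma complete_PrimRec_Suc:
  assumes f: "complete (PrimRec f h) (m # xs) r0" and h: "complete h (m # r0 # xs) z"
  shows "complete (PrimRec f h) (Suc m # xs) z"
proof (rule completeI)
  fix x cs c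
  assume sub: "PrimRec f h \<in> subterms g" and len: "length cs + size (PrimRec f h) \<le> L"
    and cs: "set cs \<subseteq> {..<K}" "c < K" "map x cs = Suc m # xs" "x c = z"
  note fact = in_facts(1)[OF sub len cs(1,2)]
  have subs: "h \<in> subterms g" using subterms_trans[OF sub] by auto
  from cs(3) obtain e cs' where e: "cs = e # cs'" "x e = Suc m" "map x cs' = xs" by auto
  obtain d r s where d: "d < K" "r < K" "d \<notin> insert c (set cs)" "r \<notin> insert c (set cs)" "d \<noteq> r"
    using fresh3[of cs c] len cs(2) by (metis add_leE)
  \<comment> \<open>\<open>d\<close> holds the predecessor of the counter and \<open>r\<close> the
    previous result; a lookalike preserves the successor relation between \<open>d\<close> and
    \<open>e\<close>.\<close>
  define x' where "x' = x(d := m, r := r0)"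
  have x'_eq: "x' k = x k" if "k \<in> insert c (set cs)" for k
    using that d by (auto simp: x'_def)
  have x': "x' d = m" "x' r = r0" "x' e = Suc m" "map x' cs' = xs" "x' c = z" "e < K" "set cs' \<subseteq> {..<K}"
    using x'_eq e cs d by (auto simp: x'_def)
  have 1: "length (d # cs') + size (PrimRec f h) \<le> L" "set (d # cs') \<subseteq> {..<K}"
    "length (d # r # cs') + size h \<le> L" "set (d # r # cs') \<subseteq> {..<K}"
    using len e d x' by auto
  have est1: "est x' (Val (PrimRec f h) (d # cs') r)"
    by (rule completeD[OF f sub 1(1,2)]) (use d x' in auto)
  have est2: "est x' (Val h (d # r # cs') c)"
    by (rule completeD[OF h subs 1(3,4)]) (use cs x' in auto)
  obtain y where y: "\<And>b. b \<in> facts \<Longrightarrow> est x' b \<longleftrightarrow> holds (map_fact y b)" "y e = Suc (y d)"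
    using lookalike[of x'] d x' by metis
  have "computes (PrimRec f h) (y d # map y cs') (y r)"
    using est1 y(1)[OF in_facts(1)[OF sub 1(1,2) d(2)]] by simp
  moreover have "computes h (y d # y r # map y cs') (y c)"
    using est2 y(1)[OF in_facts(1)[OF subs 1(3,4) cs(2)]] by simp
  ultimately have "computes (PrimRec f h) (map y cs) (y c)"
    unfolding e list.map y(2) by (rule computes.intros)
  then have "est x' (Val (PrimRec f h) cs c)" using y(1)[OF fact] by simp
  then show "est x (Val (PrimRec f h) cs c)" using fact x'_eq by (rule est_Val_upd)
qed

lemma complete_PrimRec_0:
  assumes f: "complete f xs z"
  shows "complete (PrimRec f h) (0 # xs) z"
proof (rule completeI)
  fix x cs c
  assume sub: "PrimRec f h \<in> subterms g" and len: "length cs + size (PrimRec f h) \<le> L"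
    and cs: "set cs \<subseteq> {..<K}" "c < K" "map x cs = 0 # xs" "x c = z"
  note fact = in_facts(1)[OF sub len cs(1,2)]
  have subs: "f \<in> subterms g" using subterms_trans[OF sub] by auto
  from cs(3) obtain e cs' where e: "cs = e # cs'" "x e = 0" "map x cs' = xs" by auto
  have 1: "length cs' + size f \<le> L" "set cs' \<subseteq> {..<K}" "e < K" using len e cs by auto
  have est: "est x (Val f cs' c)" using completeD[OF f subs 1(1,2) cs(2) e(3) cs(4)] .
  obtain y where y: "\<And>b. b \<in> facts \<Longrightarrow> est x b \<longleftrightarrow> holds (map_fact y b)" "y e = 0"
    using lookalike[of x] 1(3) e(2) by metis
  have "computes f (map y cs') (y c)"
    using est y(1)[OF in_facts(1)[OF subs 1(1,2) cs(2)]] by simp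
  then have "computes (PrimRec f h) (map y cs) (y c)"
    unfolding e list.map y(2) by (rule computes.intros)
  then show "est x (Val (PrimRec f h) cs c)" using y(1)[OF fact] by simp
qed

text \<open>Unboundedly many premises of the rule for \<open>Mu\<close> do not fit into one cell.
  \<open>Below\<close> collects them one at a time.\<close>

lemma est_Below:
  fixes x :: "nat \<Rightarrow> nat"
  assumes sub: "f \<in> subterms g" and len: "Suc (length cs) + size f \<le> L" and cs: "set cs \<subseteq> {..<K}"
    and f: "\<forall>m<i. \<exists>k. complete f (m # map x cs) (Suc k)"
    and c: "c < K" "x c = i"
  shows "est x (Below f c cs)"
  using f c
proof (induction i arbitrary: x c)
  case 0
  obtain y where y: "\<And>b. b \<in> facts \<Longrightarrow> est x b \<longleftrightarrow> holds (map_fact y b)" "y c = 0"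
    using lookalike[of x] 0 by metis
  have "Below f c cs \<in> facts" by (rule in_facts) (use sub len cs 0 in auto)
  then show ?case using y by simp
next
  case (Suc i)
  have fact: "Below f c' cs \<in> facts" if "c' < K" for c'
    by (rule in_facts) (use sub len cs that in auto)
  obtain k where k: "complete f (i # map x cs) (Suc k)" using Suc.prems(1) by auto
  obtain d r s where d: "d < K" "r < K" "s < K" "d \<notin> insert c (set cs)" "r \<notin> insert c (set cs)"
    "s \<notin> insert c (set cs)" "d \<noteq> r" "d \<noteq> s" "r \<noteq> s"
    using fresh3[of cs c] len Suc.prems(2) by (metis add_leE Suc_leD)
  \<comment> \<open>The coordinate \<open>s\<close> certifies that the value in \<open>r\<close> is
    positive: a lookalike makes \<open>r\<close> the successor of \<open>s\<close>.\<close>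
  define x' where "x' = x(d := i, r := Suc k, s := k)"
  have x'_eq: "x' j = x j" if "j \<in> insert c (set cs)" for j
    using that d by (auto simp: x'_def)
  have x': "x' d = i" "x' r = Suc (x' s)" "x' c = Suc (x' d)" "x' r = Suc k"
    using x'_eq Suc.prems d by (auto simp: x'_def)
  have map_x': "map x' cs = map x cs" using x'_eq by auto
  have est1: "est x' (Below f d cs)"
    using Suc.IH[of x' d] Suc.prems(1) map_x' x' d by (metis less_SucI)
  have 1: "length (d # cs) + size f \<le> L" "set (d # cs) \<subseteq> {..<K}"
    using len cs d by auto
  have est2: "est x' (Val f (d # cs) r)"
    by (rule completeD[OF k sub 1]) (use x' d map_x' in auto)
  obtain y where y: "\<And>b. b \<in> facts \<Longrightarrow> est x' b \<longleftrightarrow> holds (map_fact y b)"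
      "y c = Suc (y d)" "y r = Suc (y s)"
    using lookalike[of x'] d x' Suc.prems(2) by metis
  have "holds (Below f (y d) (map y cs))" using est1 y(1)[OF fact[OF d(1)]] by simp
  moreover have "computes f (y d # map y cs) (Suc (y s))"
    using est2 y(1)[OF in_facts(1)[OF sub 1 d(2)]] y(3) by simp
  ultimately have "holds (Below f (y c) (map y cs))"
    unfolding y(2) by (auto simp: less_Suc_eq)
  then have "est x' (Below f c cs)" using y(1)[OF fact[OF Suc.prems(2)]] by simp
  then show ?case using est_cong[OF fact[OF Suc.prems(2)], of x' x] x'_eq by simp
qed

lemma complete_Mu:
  assumes f: "complete f (i # xs) 0" and below: "\<forall>m<i. \<exists>k. complete f (m # xs) (Suc k)"
  shows "complete (Mu f) xs i"
proof (rule completeI)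
  fix x cs c
  assume sub: "Mu f \<in> subterms g" and len: "length cs + size (Mu f) \<le> L"
    and cs: "set cs \<subseteq> {..<K}" "c < K" "map x cs = xs" "x c = i"
  note fact = in_facts(1)[OF sub len cs(1,2)]
  have subs: "f \<in> subterms g" using subterms_trans[OF sub] by auto
  obtain d where d: "d < K" "d \<notin> insert c (set cs)"
    using fresh3[of cs c] len cs(2) by (metis add_leE)
  \<comment> \<open>\<open>d\<close> supplies the value \<open>0\<close> of \<open>f\<close>, which
    a lookalike preserves.\<close>
  define x' where "x' = x(d := 0)"
  have x'_eq: "x' j = x j" if "j \<in> insert c (set cs)" for j
    using that d by (auto simp: x'_def)
  have x': "x' d = 0" "x' c = i" "map x' cs = xs" using x'_eq cs by (auto simp: x'_def)
  have 1: "length (c # cs) + size f \<le> L" "set (c # cs) \<subseteq> {..<K}"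
    using len cs by auto
  have est1: "est x' (Below f c cs)"
    by (rule est_Below[OF subs]) (use len cs below x' in auto)
  have est2: "est x' (Val f (c # cs) d)"
    by (rule completeD[OF f subs 1 d(1)]) (use x' in auto)
  obtain y where y: "\<And>b. b \<in> facts \<Longrightarrow> est x' b \<longleftrightarrow> holds (map_fact y b)" "y d = 0"
    using lookalike[of x'] d x' by metis
  have "Below f c cs \<in> facts" by (rule in_facts) (use subs len cs in auto)
  then have "\<forall>m<y c. \<exists>k. computes f (m # map y cs) (Suc k)" using est1 y(1) by fastforce
  moreover have "computes f (y c # map y cs) 0"
    using est2 y(1)[OF in_facts(1)[OF subs 1 d(1)]] y(2) by simp
  ultimately have "computes (Mu f) (map y cs) (y c)" by (intro computes.intros)
  then have "est x' (Val (Mu f) cs c)" using y(1)[OF fact] by simp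
  then show "est x (Val (Mu f) cs c)" using fact x'_eq by (rule est_Val_upd)
qed

lemma computes_complete: "computes f xs y \<Longrightarrow> complete f xs y"
proof (induction rule: computes.induct)
  case (1 xs)
  show ?case
  proof (rule completeI)
    fix x :: "nat \<Rightarrow> nat" and cs c
    assume *: "Zero \<in> subterms g" "length cs + size Zero \<le> L" "set cs \<subseteq> {..<K}" "c < K" "x c = 0"
    obtain y where y: "\<And>b. b \<in> facts \<Longrightarrow> est x b \<longleftrightarrow> holds (map_fact y b)" "y c = 0"
      using lookalike[of x] * by metis
    then show "est x (Val Zero cs c)"
      using in_facts(1)[OF *(1-4)] by (simp add: computes.intros)
  qed
next
  case (2 v)
  show ?case
  proof (rule completeI)
    fix x cs c
    assume *: "Succ \<in> subterms g" "length cs + size Succ \<le> L" "set cs \<subseteq> {..<K}" "c < K"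
      "map x cs = [v]" "x c = Suc v"
    then obtain d where d: "cs = [d]" "d < K" "x d = v" by auto
    obtain y where y: "\<And>b. b \<in> facts \<Longrightarrow> est x b \<longleftrightarrow> holds (map_fact y b)" "y c = Suc (y d)"
      using lookalike[of x] * d by metis
    then show "est x (Val Succ cs c)"
      using in_facts(1)[OF *(1-4)] d by (simp add: computes.intros)
  qed
next
  case (3 i xs)
  show ?case
  proof (rule completeI)
    fix x cs c
    assume *: "Proj i \<in> subterms g" "length cs + size (Proj i) \<le> L" "set cs \<subseteq> {..<K}" "c < K"
      "map x cs = xs" "x c = xs ! i"
    then have i: "i < length cs" "x c = x (cs ! i)" using 3 by auto
    then have "cs ! i < K" using *(3) nth_mem[of i cs] by blast
    note i = i(1) this i(2)
    obtain y where y: "\<And>b. b \<in> facts \<Longrightarrow> est x b \<longleftrightarrow> holds (map_fact y b)" "y c = y (cs ! i)"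
      using lookalike[of x] * i by metis
    have "computes (Proj i) (map y cs) (map y cs ! i)" using i(1) by (intro computes.intros) simp
    then show "est x (Val (Proj i) cs c)"
      using in_facts(1)[OF *(1-4)] y i(1) by simp
  qed
next
  case (4 xs gs ys f z)
  from 4(1) have "list_all2 (\<lambda>h y. complete h xs y) gs ys" by (rule list_all2_mono) simp
  then show ?case using 4(2) by (rule complete_Comp)
next
  case (5 f xs y g)
  then show ?case by (intro complete_PrimRec_0)
next
  case (6 f g n xs r y)
  then show ?case by (intro complete_PrimRec_Suc)
next
  case (7 f n xs)
  then show ?case by (intro complete_Mu) auto
qed

lemma diverges: "\<not> computes g [n] y"
proof
  assume "computes g [n] y"
  then have *: "complete g [n] y" by (rule computes_complete)
  \<comment> \<open>Coordinates \<open>0\<close> and \<open>1\<close> are the ones named in the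
    forbidden fact of \<open>base\<close>; \<open>axis_const\<close> identifies the first with the
    input.\<close>
  let ?x = "\<lambda>i. if i = 0 then n else y"
  have "est ?x (Val g [0] 1)"
    by (rule completeD[OF *]) (use K_gt in \<open>auto simp: L_def\<close>)
  moreover have "grid ?x (cur (X 0)) = n" using axis_const[of n] K_pos by (simp add: grid_X)
  moreover have "grid ?x 0 = n" "grid ?x 2 = 0" using const(1) zero grid(1) by auto
  moreover have "sat (grid ?x) base" using sat[OF grid(1)[of ?x]] by (simp add: \<phi>_def)
  ultimately show False by (simp add: base_def est_def)
qed

end

section \<open>The standard filling\<close>

context machine
begin

lemma even_notin_zs: "even v \<Longrightarrow> v \<notin> set zs"
  using odd_var_of by (auto simp: set_zs)

lemma in_zs: "p \<in> Slots \<Longrightarrow> cur p \<in> set zs" "p \<in> Slots \<Longrightarrow> var_of (Nxt p) \<in> set zs"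
  by (auto simp: set_zs)

lemma matching_imp_diverges:
  assumes "has_3d_matching (gadget.I n)"
  shows "\<not> computes g [n] y"
proof -
  obtain Z where Z: "Z \<subseteq> variants (valuation_of (const_vals n)) zs" "\<And>\<tau>. \<tau> \<in> Z \<Longrightarrow> sat \<tau> (\<phi> n)"
    "\<And>as. length as = length rs \<Longrightarrow> \<exists>!\<tau>. \<tau> \<in> Z \<and> map \<tau> rs = as"
    "\<And>\<tau>. \<tau> \<in> Z \<Longrightarrow> \<exists>\<tau>'\<in>Z. map \<tau>' ws = map \<tau> ps"
    "\<And>\<tau>. \<tau> \<in> Z \<Longrightarrow> \<exists>\<tau>'\<in>Z. map \<tau>' ws = map \<tau> us"
    using gadget.matching_imp[OF assms] by blast
  have outside: "\<tau> v = valuation_of (const_vals n) v" if "\<tau> \<in> Z" "even v" for \<tau> v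
    using Z(1) that even_notin_zs by (auto simp: variants_def)
  interpret solution g n Z
  proof
    fix \<tau> assume \<tau>: "\<tau> \<in> Z"
    show "\<tau> 0 = n" using outside[OF \<tau>] by simp
    show "\<tau> (2 * i + 2) = i" if "i \<le> n" for i
      using outside[OF \<tau>] that by (metis dvd_add dvd_refl dvd_triv_left valuation_of_const_vals(2))
    show "sat \<tau> (\<phi> n)" using \<tau> by (rule Z)
    show "\<exists>\<tau>'\<in>Z. \<forall>p\<in>Slots. \<tau>' (cur p) = \<tau> (cur (map_slot rot p))"
      using Z(4)[OF \<tau>] by (simp add: ws_def ps_def)
    show "\<exists>\<tau>'\<in>Z. \<forall>p\<in>Slots. \<tau>' (cur p) = \<tau> (var_of (nxt p))"
      using Z(5)[OF \<tau>] by (simp add: ws_def us_def)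
    show "\<tau> = \<tau>'" if "\<tau>' \<in> Z" "\<And>k. k < K \<Longrightarrow> \<tau> (cur (X k)) = \<tau>' (cur (X k))" for \<tau>'
    proof -
      have "map \<tau> rs = map \<tau>' rs" using that(2) by (simp add: rs_def)
      then show ?thesis using Z(3)[of "map \<tau> rs"] \<tau> that(1) by auto
    qed
  next
    fix \<xi> :: "nat \<Rightarrow> atom"
    obtain \<tau> where \<tau>: "\<tau> \<in> Z" "map \<tau> rs = map \<xi> [0..<K]"
      using Z(3)[of "map \<xi> [0..<K]"] by (auto simp: rs_def)
    then have "\<forall>k<K. \<tau> (cur (X k)) = \<xi> k" by (auto simp: rs_def)
    then show "\<exists>\<tau>\<in>Z. \<forall>k<K. \<tau> (cur (X k)) = \<xi> k" using \<tau>(1) by blast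
  qed
  show ?thesis by (rule diverges)
qed

section \<open>From divergence to a matching\<close>

definition succ0 :: "(nat \<Rightarrow> nat) \<Rightarrow> nat \<Rightarrow> nat" where
  "succ0 x = x(0 := Suc (x 0))"

text \<open>Halving undoes \<open>var_of\<close>, since slot variables are the odd numbers
  \<open>2 * to_nat s + 1\<close>.\<close>

definition std :: "nat \<Rightarrow> (nat \<Rightarrow> nat) \<Rightarrow> valuation" where
  "std n x v = (if v \<in> set zs then (case from_nat (v div 2) of
       Cur p \<Rightarrow> val (map_slot x p) | Nxt p \<Rightarrow> val (map_slot (succ0 x) p))
     else valuation_of (const_vals n) v)"

lemma std_cur [simp]: "p \<in> Slots \<Longrightarrow> std n x (cur p) = val (map_slot x p)"
  using in_zs(1)[of p] by (simp add: std_def var_of_def)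

lemma std_Nxt [simp]: "p \<in> Slots \<Longrightarrow> std n x (var_of (Nxt p)) = val (map_slot (succ0 x) p)"
  using in_zs(2)[of p] by (simp add: std_def var_of_def)

lemma std_even: "even v \<Longrightarrow> std n x v = valuation_of (const_vals n) v"
  using even_notin_zs by (simp add: std_def)

definition content :: "(nat \<Rightarrow> nat) \<Rightarrow> atom list" where
  "content x = map (\<lambda>p. val (map_slot x p)) slots"

lemma map_slot_cong: "p \<in> Slots \<Longrightarrow> (\<And>k. k < K \<Longrightarrow> x k = y k) \<Longrightarrow> map_slot x p = map_slot y p"
  using set_slot_Slots by (intro slot.map_cong) auto

lemma content_eq_iff: "content x = content y \<longleftrightarrow> (\<forall>k<K. x k = y k)"
proof
  assume "content x = content y"
  then have "val (map_slot x p) = val (map_slot y p)" if "p \<in> Slots" for p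
    using that by (simp add: content_def)
  from this[of "X k" for k] show "\<forall>k<K. x k = y k" by simp
next
  assume "\<forall>k<K. x k = y k"
  then show "content x = content y"
    using map_slot_cong[of _ x y] by (auto simp: content_def)
qed

lemma std_cong:
  assumes "\<And>k. k < K \<Longrightarrow> x k = y k"
  shows "std n x = std n y"
proof
  fix v
  have s: "succ0 x k = succ0 y k" if "k < K" for k
    using assms that K_gt by (simp add: succ0_def)
  show "std n x v = std n y v"
  proof (cases "v \<in> set zs")
    case True
    then consider p where "v = cur p" "p \<in> Slots" | p where "v = var_of (Nxt p)" "p \<in> Slots"
      by (auto simp: set_zs)
    then show ?thesis
    proof cases
      case 1
      with map_slot_cong[OF 1(2) assms] show ?thesis by simp
    next
      case 2
      with map_slot_cong[OF 2(2) s] show ?thesis by simp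
    qed
  qed (simp add: std_def)
qed

lemma map_std_ws: "map (std n x) ws = content x"
  by (simp add: ws_def content_def)

lemma map_std_ps: "map (std n x) ps = content (x \<circ> rot)"
  using map_slot_in_Slots[OF _ rot_less]
  by (simp add: ps_def content_def slot.map_comp)

lemma map_std_us: "map (std n x) us = content (succ0 x)"
proof -
  have "std n x (var_of (nxt p)) = val (map_slot (succ0 x) p)" if p: "p \<in> Slots" for p
  proof -
    consider "p = X 0" | "p \<noteq> X 0" "0 \<in> set_slot p" | "0 \<notin> set_slot p" by blast
    then show ?thesis
    proof cases
      case 1
      then show ?thesis using p by (simp add: nxt_def succ0_def)
    next
      case 2
      then show ?thesis using p by (simp add: nxt_def)
    next
      case 3
      then have "map_slot (succ0 x) p = map_slot x p"
        unfolding succ0_def by (intro slot.map_cong0) (metis fun_upd_other)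
      moreover have "nxt p = Cur p" using 3 by (auto simp: nxt_def)
      ultimately show ?thesis using p by simp
    qed
  qed
  then show ?thesis by (simp add: us_def content_def)
qed

text \<open>Each standard cell witnesses its own admissibility, and divergence means that the
  forbidden fact is false whenever coordinate \<open>0\<close> is \<open>n\<close>.\<close>

lemma sat_std:
  assumes "\<And>y. \<not> computes g [n] y"
  shows "sat (std n x) (\<phi> n)"
proof -
  have vals: "std n x 0 = n" "i \<le> n \<Longrightarrow> std n x (2 * i + 2) = i" for i
  proof -
    show "std n x 0 = n" by (simp add: std_even)
    have "even (2 * i + 2)" by simp
    from std_even[OF this] show "i \<le> n \<Longrightarrow> std n x (2 * i + 2) = i"
      by (simp only: valuation_of_const_vals(2))
  qed
  have two: "std n x 2 = 0" using vals(2)[of 0] by (simp add: numeral_2_eq_2)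
  have "std n x \<in> standard" using two by (auto simp: standard_def)
  then have "sat (std n x) core" by (auto simp: core(2) same_type_def)
  moreover have "\<not> computes g [x 0] (x 1)" if "x 0 = n" using assms that by simp
  ultimately have "sat (std n x) base" using vals(1) two K_gt by (auto simp: base_def)
  moreover have "sat (std n x) (chain n)"
    unfolding sat_chain
  proof (intro allI impI)
    fix i assume i: "i < n" "std n x (cur (X 0)) = std n x (2 * i + 2)"
    have "2 * i + 4 = 2 * Suc i + 2" by simp
    then have "std n x (2 * i + 4) = std n x (2 * Suc i + 2)" by (rule arg_cong)
    also have "\<dots> = Suc i" using i(1) by (intro vals(2)) simp
    finally have "std n x (2 * i + 4) = Suc i" .
    then show "std n x (cur (S 0)) = std n x (2 * i + 4)" using i vals(2)[of i] K_gt by simp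
  qed
  ultimately show ?thesis by (simp add: \<phi>_def)
qed

lemma rot_inverse:
  assumes "j < K"
  shows "rot ((j + (K - 1)) mod K) = j" "(rot j + (K - 1)) mod K = j"
proof -
  have *: "Suc (j + (K - 1)) = j + K" "Suc j + (K - 1) = j + K" using K_gt by simp_all
  have "rot ((j + (K - 1)) mod K) = Suc (j + (K - 1)) mod K" by (simp add: rot_def mod_Suc_eq)
  then show "rot ((j + (K - 1)) mod K) = j" unfolding * using assms by simp
  have "(rot j + (K - 1)) mod K = (Suc j + (K - 1)) mod K" unfolding rot_def by (rule mod_add_left_eq)
  then show "(rot j + (K - 1)) mod K = j" unfolding * using assms by simp
qed

text \<open>Rotation permutes the standard cells, so \<open>ps\<close> and \<open>ws\<close> take
  the same values. An increment makes coordinate \<open>0\<close> positive, so \<open>us\<close>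
  misses infinitely many of them.\<close>

lemma diverges_imp_matching:
  assumes "\<And>y. \<not> computes g [n] y"
  shows "has_3d_matching (gadget.I n)"
proof (rule gadget.matching_if)
  let ?Z = "range (std n)"
  show "?Z \<subseteq> variants (valuation_of (const_vals n)) zs"
    by (auto simp: variants_def std_def)
  show "sat \<tau> (\<phi> n)" if "\<tau> \<in> ?Z" for \<tau> using that sat_std[OF assms] by auto
  have rs: "map (std n x) rs = map x [0..<K]" for x by (simp add: rs_def)
  show "bij_betw (\<lambda>\<tau>. map \<tau> rs) ?Z {as. length as = length rs}"
  proof (rule bij_betw_imageI)
    show "inj_on (\<lambda>\<tau>. map \<tau> rs) ?Z"
    proof (rule inj_onI, elim rangeE, hypsubst, rule std_cong)
      fix x y k assume "map (std n x) rs = map (std n y) rs" "k < K"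
      then show "x k = y k" by (simp only: rs map_eq_conv) simp
    qed
    show "(\<lambda>\<tau>. map \<tau> rs) ` ?Z = {as. length as = length rs}"
    proof (intro equalityI subsetI)
      fix as :: "atom list" assume "as \<in> {as. length as = length rs}"
      then have "map (std n (\<lambda>i. as ! i)) rs = as"
        unfolding rs by (auto simp: rs_def intro: nth_equalityI)
      then show "as \<in> (\<lambda>\<tau>. map \<tau> rs) ` ?Z" by (metis (mono_tags) image_eqI rangeI)
    qed auto
  qed
  show "inj_on (\<lambda>\<tau>. map \<tau> ps) ?Z"
  proof (rule inj_onI, elim rangeE, hypsubst, rule std_cong)
    fix x y k assume "map (std n x) ps = map (std n y) ps" and k: "k < K"
    then have "\<forall>j<K. x (rot j) = y (rot j)" by (simp add: map_std_ps content_eq_iff)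
    then have "x (rot ((k + (K - 1)) mod K)) = y (rot ((k + (K - 1)) mod K))"
      using K_gt by auto
    then show "x k = y k" by (simp only: rot_inverse[OF k])
  qed
  show "(\<lambda>\<tau>. map \<tau> ps) ` ?Z = (\<lambda>\<tau>. map \<tau> ws) ` ?Z"
  proof -
    have "content x \<in> range (\<lambda>y. content (y \<circ> rot))" for x
    proof
      show "content x = content ((\<lambda>j. x ((j + (K - 1)) mod K)) \<circ> rot)"
        unfolding content_eq_iff comp_def using rot_inverse(2) by metis
    qed simp
    then show ?thesis by (auto simp: image_image map_std_ps map_std_ws)
  qed
  show "inj_on (\<lambda>\<tau>. map \<tau> us) ?Z"
  proof (rule inj_onI, elim rangeE, hypsubst, rule std_cong)
    fix x y k assume "map (std n x) us = map (std n y) us" and k: "k < K"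
    then have "\<forall>j<K. succ0 x j = succ0 y j" by (simp add: map_std_us content_eq_iff)
    then have "succ0 x k = succ0 y k" using k by simp
    then show "x k = y k" by (auto simp: succ0_def split: if_splits)
  qed
  show "(\<lambda>\<tau>. map \<tau> us) ` ?Z \<subseteq> (\<lambda>\<tau>. map \<tau> ws) ` ?Z"
    by (auto simp: image_image map_std_us map_std_ws)
  \<comment> \<open>These cells have coordinate \<open>0\<close> equal to zero, so none is the
    result of an increment; coordinate \<open>1\<close> keeps them distinct.\<close>
  define e where "e m = content (\<lambda>k. if k = 1 then m else 0)" for m
  have "inj e"
  proof (rule injI)
    fix i j assume "e i = e j"
    then have "\<forall>k<K. (if k = 1 then i else 0) = (if k = 1 then j else 0)"
      unfolding e_def content_eq_iff .
    from this[rule_format, OF K_gt] show "i = j" by simp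
  qed
  then have "infinite (range e)" by (rule range_inj_infinite)
  moreover have "range e \<subseteq> (\<lambda>\<tau>. map \<tau> ws) ` ?Z - (\<lambda>\<tau>. map \<tau> us) ` ?Z"
  proof -
    have "e m \<noteq> content (succ0 x)" for m x
      using K_gt by (auto simp: e_def content_eq_iff succ0_def intro!: exI[of _ 0])
    then show ?thesis by (auto simp: image_image map_std_us map_std_ws) (auto simp: e_def)
  qed
  ultimately show "infinite ((\<lambda>\<tau>. map \<tau> ws) ` ?Z - (\<lambda>\<tau>. map \<tau> us) ` ?Z)"
    using finite_subset by blast
qed

end


section \<open>Recursive functions\<close>

lemma computes_Comp1: "computes g xs v \<Longrightarrow> computes f [v] z \<Longrightarrow> computes (Comp f [g]) xs z"
  by (rule computes.intros(4)[of xs "[g]" "[v]"]) auto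

definition computable :: "nat \<Rightarrow> (nat list \<Rightarrow> nat) \<Rightarrow> bool" where
  "computable k F \<longleftrightarrow> (\<exists>r. \<forall>xs. length xs = k \<longrightarrow> computes r xs (F xs))"

lemma computable_const: "computable k (\<lambda>_. c)"
proof (induction c)
  case 0
  show ?case unfolding computable_def by (blast intro: computes.intros(1))
next
  case (Suc c)
  then obtain r where r: "\<forall>xs. length xs = k \<longrightarrow> computes r xs c"
    unfolding computable_def by blast
  then have "computes (Comp Succ [r]) xs (Suc c)" if "length xs = k" for xs
    using that by (blast intro: computes_Comp1 computes.intros(2))
  then show ?case unfolding computable_def by blast
qed

lemma computable_proj: "i < k \<Longrightarrow> computable k (\<lambda>xs. xs ! i)"
  unfolding computable_def by (metis computes.intros(3))

lemma computable_comp1: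
  assumes "computable 1 (\<lambda>xs. F (xs ! 0))" "computable k G"
  shows "computable k (\<lambda>xs. F (G xs))"
proof -
  obtain f g where f: "\<And>xs. length xs = 1 \<Longrightarrow> computes f xs (F (xs ! 0))"
    and g: "\<And>xs. length xs = k \<Longrightarrow> computes g xs (G xs)"
    using assms unfolding computable_def by blast
  have "computes (Comp f [g]) xs (F (G xs))" if "length xs = k" for xs
    using f[of "[G xs]"] g[OF that] by (auto intro: computes_Comp1)
  then show ?thesis unfolding computable_def by blast
qed

lemma computable_comp2:
  assumes "computable 2 (\<lambda>xs. F (xs ! 0) (xs ! 1))" "computable k G" "computable k H"
  shows "computable k (\<lambda>xs. F (G xs) (H xs))"
proof -
  obtain f g h where f: "\<And>xs. length xs = 2 \<Longrightarrow> computes f xs (F (xs ! 0) (xs ! 1))"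
    and gh: "\<And>xs. length xs = k \<Longrightarrow> computes g xs (G xs)" "\<And>xs. length xs = k \<Longrightarrow> computes h xs (H xs)"
    using assms unfolding computable_def by blast
  have "computes (Comp f [g, h]) xs (F (G xs) (H xs))" if "length xs = k" for xs
    using f[of "[G xs, H xs]"] gh that
    by (intro computes.intros(4)[of xs "[g, h]" "[G xs, H xs]"]) auto
  then show ?thesis unfolding computable_def by blast
qed

lemma computable_primrec:
  assumes "computable 2 (\<lambda>xs. H (xs ! 0) (xs ! 1))"
    and "F 0 = c" "\<And>i. F (Suc i) = H i (F i)"
  shows "computable 1 (\<lambda>xs. F (xs ! 0))"
proof -
  obtain a h where a: "computes a [] c"
    and h: "\<And>xs. length xs = 2 \<Longrightarrow> computes h xs (H (xs ! 0) (xs ! 1))"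
    using assms(1) computable_const[of 0 c] unfolding computable_def by auto
  have "computes (PrimRec a h) [i] (F i)" for i
  proof (induction i)
    case 0
    show ?case using a by (simp add: assms(2) computes.intros)
  next
    case (Suc i)
    then show ?case using h[of "[i, F i]"] assms(3) by (auto intro: computes.intros)
  qed
  then have "computes (PrimRec a h) xs (F (xs ! 0))" if "length xs = 1" for xs
    using that by (auto simp: length_Suc_conv)
  then show ?thesis unfolding computable_def by blast
qed

lemma computable_primrec_param:
  assumes "computable 1 (\<lambda>xs. A (xs ! 0))" "computable 3 (\<lambda>xs. H (xs ! 0) (xs ! 1) (xs ! 2))"
    and "\<And>y. F 0 y = A y" "\<And>i y. F (Suc i) y = H i (F i y) y"
  shows "computable 2 (\<lambda>xs. F (xs ! 0) (xs ! 1))"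
proof -
  obtain a h where a: "\<And>xs. length xs = 1 \<Longrightarrow> computes a xs (A (xs ! 0))"
    and h: "\<And>xs. length xs = 3 \<Longrightarrow> computes h xs (H (xs ! 0) (xs ! 1) (xs ! 2))"
    using assms(1,2) unfolding computable_def by blast
  have "computes (PrimRec a h) [i, y] (F i y)" for i y
  proof (induction i)
    case 0
    show ?case using a[of "[y]"] by (simp add: assms(3) computes.intros)
  next
    case (Suc i)
    then show ?case using h[of "[i, F i y, y]"] assms(4) by (auto intro: computes.intros)
  qed
  then have "computes (PrimRec a h) xs (F (xs ! 0) (xs ! 1))" if "length xs = 2" for xs
    using that by (auto simp: length_Suc_conv numeral_2_eq_2)
  then show ?thesis unfolding computable_def by blast
qed

lemma computable_Suc:
  assumes "computable k F"
  shows "computable k (\<lambda>xs. Suc (F xs))"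
proof (rule computable_comp1[OF _ assms])
  have "computes Succ xs (Suc (xs ! 0))" if "length xs = 1" for xs
    using that by (auto simp: length_Suc_conv intro: computes.intros)
  then show "computable 1 (\<lambda>xs. Suc (xs ! 0))" unfolding computable_def by blast
qed

lemma computable_add:
  assumes "computable k F" "computable k G"
  shows "computable k (\<lambda>xs. F xs + G xs)"
proof (rule computable_comp2[OF _ assms])
  show "computable 2 (\<lambda>xs. xs ! 0 + xs ! 1)"
    by (rule computable_primrec_param[where A = "\<lambda>y. y" and H = "\<lambda>i r y. Suc r"])
      (auto intro!: computable_proj computable_Suc)
qed

lemma computable_diff:
  assumes "computable k F" "computable k G"
  shows "computable k (\<lambda>xs. F xs - G xs)"
proof -
  have pred: "computable 1 (\<lambda>xs. xs ! 0 - 1)"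
    by (rule computable_primrec[where H = "\<lambda>i r. i"]) (auto intro: computable_proj)
  have "computable 3 (\<lambda>xs. xs ! 1 - 1)"
    by (rule computable_comp1[OF pred computable_proj]) simp
  \<comment> \<open>The recursion runs over the first argument, which must be the subtrahend; the
    arguments are swapped afterwards.\<close>
  then have "computable 2 (\<lambda>xs. (\<lambda>i y. y - i) (xs ! 0) (xs ! 1))"
    by (intro computable_primrec_param[where A = "\<lambda>y. y" and H = "\<lambda>i r y. r - 1"])
      (auto intro: computable_proj)
  from computable_comp2[OF this assms(2,1)] show ?thesis .
qed

section \<open>Coding and decoding of pairs\<close>

lemma computable_triangle:
  assumes "computable k F"
  shows "computable k (\<lambda>xs. triangle (F xs))"
proof (rule computable_comp1[OF _ assms])
  show "computable 1 (\<lambda>xs. triangle (xs ! 0))"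
    by (rule computable_primrec[where H = "\<lambda>i r. r + Suc i"])
      (auto intro!: computable_proj computable_Suc computable_add)
qed

lemma computable_prod_encode:
  assumes "computable k F" "computable k G"
  shows "computable k (\<lambda>xs. prod_encode (F xs, G xs))"
  unfolding prod_encode_def using assms by (auto intro!: computable_add computable_triangle)

text \<open>The sum of the components of a pair, computed by walking along the enumeration of pairs.\<close>

primrec diagonal :: "nat \<Rightarrow> nat" where
  "diagonal 0 = 0"
| "diagonal (Suc p) = diagonal p + (1 - (diagonal p - (p - triangle (diagonal p))))"

lemma triangle_mono: "i \<le> j \<Longrightarrow> triangle i \<le> triangle j"
  by (induction rule: dec_induct) auto

text \<open>By this invariant the correction term in \<open>diagonal\<close> is \<open>1\<close>
  exactly at the last pair of a diagonal, and \<open>0\<close> otherwise.\<close>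

lemma diagonal_bounds: "triangle (diagonal p) \<le> p \<and> p \<le> triangle (diagonal p) + diagonal p"
proof (induction p)
  case (Suc p)
  show ?case
  proof (cases "p = triangle (diagonal p) + diagonal p")
    case True
    then have "diagonal (Suc p) = Suc (diagonal p)" by simp
    then show ?thesis using True by simp
  next
    case False
    then have "diagonal (Suc p) = diagonal p" using Suc by auto
    then show ?thesis using Suc False by simp
  qed
qed simp

lemma diagonal_prod_encode: "diagonal (prod_encode (i, j)) = i + j"
proof (rule ccontr)
  let ?p = "prod_encode (i, j)"
  have p: "triangle (i + j) \<le> ?p" "?p \<le> triangle (i + j) + (i + j)" by (simp_all add: prod_encode_def)
  assume "diagonal ?p \<noteq> i + j"
  then consider "Suc (i + j) \<le> diagonal ?p" | "Suc (diagonal ?p) \<le> i + j" by linarith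
  then show False
  proof cases
    case 1
    from triangle_mono[OF this] p diagonal_bounds[of ?p] show False by simp
  next
    case 2
    from triangle_mono[OF this] p diagonal_bounds[of ?p] show False by simp
  qed
qed

lemma prod_decode_diagonal:
  "fst (prod_decode p) = p - triangle (diagonal p)"
  "snd (prod_decode p) = diagonal p - (p - triangle (diagonal p))"
proof -
  obtain i j where "p = prod_encode (i, j)" by (metis prod_decode_inverse surj_pair)
  then show "fst (prod_decode p) = p - triangle (diagonal p)"
    "snd (prod_decode p) = diagonal p - (p - triangle (diagonal p))"
    by (simp_all add: diagonal_prod_encode, simp_all add: prod_encode_def)
qed

lemma computable_diagonal:
  assumes "computable k F"
  shows "computable k (\<lambda>xs. diagonal (F xs))"
proof (rule computable_comp1[OF _ assms])
  show "computable 1 (\<lambda>xs. diagonal (xs ! 0))"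
    by (rule computable_primrec[where
          H = "\<lambda>i r. r + (1 - (r - (i - triangle r)))"])
      (auto intro!: computable_proj computable_const computable_add computable_diff computable_triangle)
qed

lemma computable_prod_decode:
  assumes "computable k F"
  shows "computable k (\<lambda>xs. fst (prod_decode (F xs)))" "computable k (\<lambda>xs. snd (prod_decode (F xs)))"
  unfolding prod_decode_diagonal
  using assms by (auto intro!: computable_diff computable_triangle computable_diagonal)

lemmas computable_intros =
  computable_proj computable_const computable_Suc computable_add computable_prod_encode computable_prod_decode

lemma computable_code_chain:
  assumes "computable k F"
  shows "computable k (\<lambda>xs. code_fm (chain (F xs)))"
proof (rule computable_comp1[OF _ assms])
  \<comment> \<open>The numbers \<open>0\<close> to \<open>3\<close> in first components are the
    constructor tags of \<open>code_fm\<close>; \<open>xs ! 0\<close> is the index and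
    \<open>xs ! 1\<close> the code obtained so far.\<close>
  have "computable 2 (\<lambda>xs. prod_encode (2, prod_encode (xs ! 1, prod_encode (3, prod_encode
      (prod_encode (1, prod_encode (0, prod_encode (cur (X 0), xs ! 0 + xs ! 0 + 2))),
       prod_encode (0, prod_encode (cur (S 0), xs ! 0 + xs ! 0 + 4)))))))"
    by (intro computable_intros) simp_all
  then show "computable 1 (\<lambda>xs. code_fm (chain (xs ! 0)))"
    by (rule computable_primrec[where F = "\<lambda>i. code_fm (chain i)"])
      (rule refl, simp only: chain.simps code_fm.simps mult_2)
qed

lemma computable_code_const_vals:
  assumes "computable k F"
  shows "computable k (\<lambda>xs. list_encode (map prod_encode (const_vals (F xs))))"
proof -
  have "computable 2 (\<lambda>xs. Suc (prod_encode (prod_encode (xs ! 0 + xs ! 0 + 4, Suc (xs ! 0)), xs ! 1)))"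
    by (intro computable_intros) simp_all
  then have "computable 1 (\<lambda>xs. list_encode (map prod_encode (chain_vals (xs ! 0))))"
    by (rule computable_primrec[where F = "\<lambda>i. list_encode (map prod_encode (chain_vals i))"])
      (rule refl, simp only: chain_vals.simps list.map list_encode.simps mult_2)
  from computable_comp1[OF this assms] show ?thesis
    unfolding const_vals_def list.map list_encode.simps by (intro computable_intros assms)
qed


section \<open>The diagonal argument\<close>

text \<open>\<open>assemble p\<close> is the code of an instance, given a tuple \<open>p\<close> of the codes of its parts that do
  not depend on the input; the input is \<open>p\<close> itself.\<close>

definition assemble :: "nat \<Rightarrow> nat" where
  "assemble p = (let h = (\<lambda>q. fst (prod_decode q)); t = (\<lambda>q. snd (prod_decode q)) in
     prod_encode (h p, prod_encode (h (t p), prod_encode (h (t (t p)),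
       prod_encode (prod_encode (1, Suc (prod_encode
         (prod_encode (h (t (t (t p))), prod_encode (h (t (t (t (t p)))),
            prod_encode (2, prod_encode (h (t (t (t (t (t p))))), code_fm (chain p))))),
          t (t (t (t (t (t p)))))))),
       list_encode (map prod_encode (const_vals p)))))))"

lemma computable_assemble: "computable 1 (\<lambda>xs. assemble (xs ! 0))"
  unfolding assemble_def Let_def
  by (intro computable_intros computable_code_chain computable_code_const_vals) simp_all

context machine
begin

definition parts :: nat where
  "parts = prod_encode (code_presentation gadget.A, prod_encode (code_presentation gadget.B,
     prod_encode (code_presentation gadget.C, prod_encode (code_expr gadget.present_expr,
       prod_encode (list_encode zs, prod_encode (code_fm base,
         list_encode (map code_builder gadget.rest)))))))"

text \<open>\<open>assemble\<close> uses its argument both as the record of constant parts and as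
  the input. At \<open>parts\<close> the two roles meet, which replaces an appeal to the recursion
  theorem.\<close>

lemma code_instance: "code_3dm (gadget.I parts) = assemble parts"
proof -
  have "prod_decode parts = (code_presentation gadget.A, prod_encode (code_presentation gadget.B,
     prod_encode (code_presentation gadget.C, prod_encode (code_expr gadget.present_expr,
       prod_encode (list_encode zs, prod_encode (code_fm base,
         list_encode (map code_builder gadget.rest)))))))"
    by (simp add: parts_def)
  then show ?thesis
    unfolding assemble_def gadget.I_def gadget.R_def Let_def unfolding \<phi>_def
    by (simp only: code_3dm.simps code_presentation.simps code_expr.simps code_builder.simps
        code_fm.simps list.map list_encode.simps fst_conv snd_conv prod_encode_inverse)
qed

lemma has_3d_matching_iff: "has_3d_matching (gadget.I n) \<longleftrightarrow> (\<nexists>y. computes g [n] y)"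
  using matching_imp_diverges diverges_imp_matching by blast

end

theorem theorem3p19:
  shows "\<not> decidable_problem code_3dm valid_3dm has_3d_matching"
proof
  assume "decidable_problem code_3dm valid_3dm has_3d_matching"
  then obtain f where f: "\<And>i. valid_3dm i \<Longrightarrow> computes f [code_3dm i] (if has_3d_matching i then 1 else 0)"
    unfolding decidable_problem_def by blast
  obtain r where r: "\<And>p. computes r [p] (assemble p)"
    using computable_assemble unfolding computable_def by (metis One_nat_def length_Cons list.size(3) nth_Cons_0)
  have "computable 1 (\<lambda>xs. 1 - xs ! 0)"
    by (intro computable_diff computable_const computable_proj) simp
  then obtain neg where neg: "\<And>v. computes neg [v] (1 - v)"
    unfolding computable_def by (metis One_nat_def length_Cons list.size(3) nth_Cons_0)
  \<comment> \<open>\<open>Proj 1\<close> skips the search counter of \<open>Mu\<close>, so on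
    \<open>parts\<close> the search stops at once if \<open>f\<close> reports a matching and never
    stops otherwise. \<open>h\<close> is fixed before \<open>parts\<close>, which arrives as the
    input, so nothing is circular.\<close>
  define h where "h = Comp neg [Comp f [Comp r [Proj 1]]]"
  interpret machine "Mu h" .
  define b :: nat where "b = (if has_3d_matching (gadget.I parts) then 1 else 0)"
  have "computes f [assemble parts] b"
    using f[OF gadget.valid, of parts] by (simp only: code_instance b_def)
  moreover have "computes (Proj 1) [y, parts] parts" for y
    using computes.intros(3)[of 1 "[y, parts]"] by simp
  ultimately have h: "computes h [y, parts] (1 - b)" for y
    unfolding h_def using r neg by (blast intro: computes_Comp1)
  show False
  proof (cases "has_3d_matching (gadget.I parts)")
    case True
    then have "computes h [0, parts] 0" using h by (simp add: b_def)
    then have "computes (Mu h) [parts] 0" by (intro computes.intros) auto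
    with True show False by (simp add: has_3d_matching_iff)
  next
    case False
    then obtain y where "computes (Mu h) [parts] y" by (auto simp: has_3d_matching_iff)
    then have "computes h [y, parts] 0" by (rule computes_MuE) simp
    with computes_deterministic[OF h] have "1 - b = 0" by blast
    with False show False by (simp add: b_def)
  qed
qed

end
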